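(* Assume $\operatorname{tr} B\ge 0$. Suppose there exist constants $D>0$ and $\gamma_D>0$ such that $V(t)\ge \gamma_D\, t^{D/2}$ for every $t>0$. Then for every $0<s<1/2$ there exists a constant $i(s)>0$, depending only on $N,D,s,\gamma_D$, such that for every measurable set $E\subset\mathbb{R}^N$ with $|E|<\infty$, $$\mathfrak P^{\mathscr A}_s(E)\ \ge\ i(s)\,|E|^{\frac{D-2s}{D}}.$$
   Context: Let $N\ge 2$. Let $Q,B$ be real constant $N\times N$ matrices with $Q=Q^\star\ge 0$, and let $\mathscr A u=\operatorname{tr}(Q\nabla^2u)+\langle BX,\nabla u\rangle$ on $\mathbb{R}^N$. Assume that $K(t)=\frac1t\int_0^t e^{rB}Qe^{rB^\star}\,dr$ is positive definite for every $t>0$. Let $\omega_N$ be the volume of the unit ball of $\mathbb{R}^N$, $V(t)=\omega_N(\det(tK(t)))^{1/2}$, $m_t(X,Y)^2=\langle K(t)^{-1}(Y-e^{tB}X),\,Y-e^{tB}X\rangle$, and $p(X,Y,t)=(4\pi)^{-N/2}(\det(tK(t)))^{-1/2}\exp\!\big(-m_t(X,Y)^2/(4t)\big)$. The semigroup is $P_tf(X)=\int_{\mathbb{R}^N}p(X,Y,t)f(Y)\,dY$, $t>0$. $\mathscr S$ is the Schwartz class on $\mathbb{R}^N$; $L^p=L^p(\mathbb{R}^N)$; $|E|$ is Lebesgue measure and $\mathbf 1_E$ the indicator function. For $0<s<1$ and $f\in\mathscr S$, $(-\mathscr A)^sf(X)=-\frac{s}{\Gamma(1-s)}\int_0^\infty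 t^{-1-s}\,[P_tf(X)-f(X)]\,dt$ (when $\operatorname{tr}B\ge0$ this lies in $L^1$). Nonlocal perimeter: for $f\in L^1$ let $\mathscr F(f)$ be the set of sequences $\{f_k\}_{k\in\mathbb N}\subset\mathscr S$ with $f_k\to f$ in $L^1$; for $0<s<1/2$ and measurable $E$ with $|E|<\infty$, $$\mathfrak P^{\mathscr A}_s(E)=\inf_{\{f_k\}\in\mathscr F(\mathbf 1_E)}\ \liminf_{k\to\infty}\|(-\mathscr A)^sf_k\|_{L^1}\in[0,\infty].$$ *)

theory Defs
  imports "HOL-Analysis.Analysis"
begin

fun mpow :: "real^'n::finite^'n \<Rightarrow> nat \<Rightarrow> real^'n^'n" where
  "mpow M 0 = mat 1"
| "mpow M (Suc k) = M ** mpow M k"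

definition mexp :: "real^'n::finite^'n \<Rightarrow> real^'n^'n" where
  "mexp M = (\<chi> i j. \<Sum>k. (mpow M k $ i $ j) / fact k)"

definition Kmat :: "real^'n::finite^'n \<Rightarrow> real^'n^'n \<Rightarrow> real \<Rightarrow> real^'n^'n" where
  "Kmat Q B t = (1 / t) *\<^sub>R
     (\<chi> i j. LBINT r=0..t. (mexp (r *\<^sub>R B) ** Q ** transpose (mexp (r *\<^sub>R B))) $ i $ j)"

definition pos_def_mat :: "real^'n::finite^'n \<Rightarrow> bool" where
  "pos_def_mat M \<longleftrightarrow> (\<forall>x. x \<noteq> 0 \<longrightarrow> x \<bullet> (M *v x) > 0)"

definition psd_mat :: "real^'n::finite^'n \<Rightarrow> bool" where
  "psd_mat M \<longleftrightarrow> (\<forall>x. x \<bullet> (M *v x) \<ge> 0)"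

definition omegaN :: "'n::finite itself \<Rightarrow> real" where
  "omegaN _ = measure lborel (ball (0::real^'n) 1)"

definition Vol :: "real^'n::finite^'n \<Rightarrow> real^'n^'n \<Rightarrow> real \<Rightarrow> real" where
  "Vol Q B t = omegaN TYPE('n) * sqrt (det (t *\<^sub>R Kmat Q B t))"

definition msq :: "real^'n::finite^'n \<Rightarrow> real^'n^'n \<Rightarrow> real \<Rightarrow> real^'n \<Rightarrow> real^'n \<Rightarrow> real" where
  "msq Q B t X Y = (Y - mexp (t *\<^sub>R B) *v X) \<bullet> (matrix_inv (Kmat Q B t) *v (Y - mexp (t *\<^sub>R B) *v X))"

definition heat_kernel :: "real^'n::finite^'n \<Rightarrow> real^'n^'n \<Rightarrow> real^'n \<Rightarrow> real^'n \<Rightarrow> real \<Rightarrow> real" where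
  "heat_kernel Q B X Y t = (4 * pi) powr (- real CARD('n) / 2)
      * det (t *\<^sub>R Kmat Q B t) powr (-1/2) * exp (- msq Q B t X Y / (4 * t))"

definition semigroup :: "real^'n::finite^'n \<Rightarrow> real^'n^'n \<Rightarrow> real \<Rightarrow> (real^'n \<Rightarrow> real) \<Rightarrow> real^'n \<Rightarrow> real" where
  "semigroup Q B t f X = (\<integral>Y. heat_kernel Q B X Y t * f Y \<partial>lborel)"

definition partial_d :: "'n::finite \<Rightarrow> (real^'n \<Rightarrow> real) \<Rightarrow> real^'n \<Rightarrow> real" where
  "partial_d i f x = deriv (\<lambda>h. f (x + h *\<^sub>R axis i 1)) 0"

fun pderivs :: "'n::finite list \<Rightarrow> (real^'n \<Rightarrow> real) \<Rightarrow> real^'n \<Rightarrow> real" where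
  "pderivs [] f = f"
| "pderivs (i # is) f = partial_d i (pderivs is f)"

definition schwartz :: "(real^'n::finite \<Rightarrow> real) \<Rightarrow> bool" where
  "schwartz f \<longleftrightarrow>
     (\<forall>is. continuous_on UNIV (pderivs is f)) \<and>
     (\<forall>is i x. (\<lambda>h. pderivs is f (x + h *\<^sub>R axis i 1)) differentiable (at 0)) \<and>
     (\<forall>is (m::nat). bounded (range (\<lambda>x. (1 + norm x) ^ m * pderivs is f x)))"

definition frac_pow :: "real^'n::finite^'n \<Rightarrow> real^'n^'n \<Rightarrow> real \<Rightarrow> (real^'n \<Rightarrow> real) \<Rightarrow> real^'n \<Rightarrow> real" where
  "frac_pow Q B s f X = - (s / Gamma (1 - s)) *
     (LINT t:{0<..}|lborel. t powr (-1 - s) * (semigroup Q B t f X - f X))"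

definition L1norm :: "(real^'n::finite \<Rightarrow> real) \<Rightarrow> ennreal" where
  "L1norm g = (\<integral>\<^sup>+ x. ennreal \<bar>g x\<bar> \<partial>lborel)"

definition approx_seqs :: "(real^'n::finite \<Rightarrow> real) \<Rightarrow> (nat \<Rightarrow> real^'n \<Rightarrow> real) set" where
  "approx_seqs f = {fs. (\<forall>k. schwartz (fs k)) \<and> (\<lambda>k. L1norm (\<lambda>x. fs k x - f x)) \<longlonglongrightarrow> 0}"

definition nl_perimeter :: "real^'n::finite^'n \<Rightarrow> real^'n^'n \<Rightarrow> real \<Rightarrow> (real^'n) set \<Rightarrow> ennreal" where
  "nl_perimeter Q B s E =
     (INF fs \<in> approx_seqs (indicator E). liminf (\<lambda>k. L1norm (frac_pow Q B s (fs k))))"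

end

theory Submission
  imports Defs "HOL-Probability.Probability"
begin

text \<open>
  Write $p$ for the heat kernel, $P_t$ for the semigroup and $g = (-\mathscr A)^s f$ for a Schwartz function $f$.
  For a Borel set $E$ of finite measure put $\psi_\tau(Y) = \int_E p(X,Y,\tau)\,dX$, which lies in $[0,1]$ because
  $\operatorname{tr} B \ge 0$, and $a(\tau) = \int \psi_\tau f$. By Chapman--Kolmogorov
  $a(\tau+u) - a(\tau) = \int \psi_\tau (P_u f - f)$, so by Fubini
  $\int_0^\infty u^{-1-s} (a(\tau+u) - a(\tau))\,du = -\frac{\Gamma(1-s)}{s} \int \psi_\tau g
  \ge -\frac{\Gamma(1-s)}{s} \|g\|_1$.
  Evaluating the left-hand side at a maximum point of $a$ on $[0,t]$ gives the one-dimensional maximum principle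
  $a(0) \le \sup_{\sigma \ge t} a(\sigma) + \Gamma(1-s)\, t^s \|g\|_1$. If $f$ is $L^1$-close to
  $\mathbf 1_E$, then $a(0)$ is close to $|E|$, while the volume growth gives $a(\sigma) \lesssim |E|^2 t^{-D/2}$
  for $\sigma \ge t$; the choice $t^{D/2} \sim |E|$ yields the inequality.

  Fubini needs $\|P_u f - f\|_1 = O(u^\theta)$ for some $\theta > s$. As $s < 1/2$, the exponent
  $\theta = 1/2$ suffices, and this only uses first derivatives of $f$ and first moments of Gaussians.
\<close>

section \<open>Linear changes of variables\<close>

text \<open>If \<open>a\<close> were maximal at time 0, pairing with the indicator of
  \<open>E\<close> alone would do. It need not be: \<open>f\<close> is merely L1-close to the
  indicator, so \<open>a\<close> may rise at first. Hence the test functions form a family indexed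
  by \<tau>. Wherever the maximum point lies, values in [0,1] bound the pairing by one and the same
  L1 norm, and the operator only ever acts on \<open>f\<close> itself.

  The constant may depend on \<open>Q\<close> and \<open>B\<close> only through \<gamma> and
  \<open>D\<close>, which separates two kinds of estimates. Moments of Gaussians and the size of the
  flow depend on \<open>Q\<close>, \<open>B\<close> and \<open>f\<close>; they serve only for Fubini
  and for the continuity of \<open>a\<close>. The quantitative inputs are total mass at most one in
  either variable of the kernel and the sup bound on the kernel supplied by the volume growth.

  The factor 4 in the constant is bookkeeping: with m = |E|, the L1 error m/8 is lost twice, the
  choice of \<open>t\<close> makes the kernel at most 1/(2m) and so loses m/2, and m/4
  survives.\<close>

lemma nn_integral_lborel_plus:
  fixes f :: "'a::euclidean_space \<Rightarrow> ennreal"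
  assumes [measurable]: "f \<in> borel_measurable borel"
  shows "(\<integral>\<^sup>+x. f (c + x) \<partial>lborel) = (\<integral>\<^sup>+x. f x \<partial>lborel)"
  using nn_integral_distr[of "(+) c" lborel borel f] by (simp add: lborel_distr_plus)

text \<open>Fubini isolates the coordinate along \<open>e\<close>. Once the other coordinates are
  frozen, \<open>x \<bullet> e'\<close> is a constant because \<open>e'\<close> differs from
  \<open>e\<close>, so the shear is a translation of a single real variable.\<close>

lemma nn_integral_lborel_shear:
  fixes f :: "'a::euclidean_space \<Rightarrow> ennreal"
  assumes [measurable]: "f \<in> borel_measurable borel"
    and e: "e \<in> Basis" "e' \<in> Basis" "e \<noteq> e'"
  shows "(\<integral>\<^sup>+x. f (x + (x \<bullet> e') *\<^sub>R e) \<partial>lborel) = (\<integral>\<^sup>+x. f x \<partial>lborel)"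
proof -
  let ?I = "Basis - {e}"
  let ?T = "\<lambda>g. \<Sum>b\<in>(Basis::'a set). g b *\<^sub>R b"
  let ?M = "\<Pi>\<^sub>M b\<in>(Basis::'a set). (lborel::real measure)"
  have ins: "insert e ?I = Basis" using e by auto
  interpret product_sigma_finite "\<lambda>_::'a. lborel::real measure" ..
  have fold: "(\<integral>\<^sup>+x. h (?T x) \<partial>?M) = (\<integral>\<^sup>+x. (\<integral>\<^sup>+y. h (?T (x(e := y))) \<partial>lborel) \<partial>(\<Pi>\<^sub>M b\<in>?I. lborel))"
    if [measurable]: "h \<in> borel_measurable borel" for h :: "'a \<Rightarrow> ennreal"
    using product_nn_integral_insert[of ?I e "\<lambda>x. h (?T x)"] unfolding ins by simp
  have "(\<integral>\<^sup>+x. f (x + (x \<bullet> e') *\<^sub>R e) \<partial>lborel) = (\<integral>\<^sup>+x. f (?T x + (?T x \<bullet> e') *\<^sub>R e) \<partial>?M)"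
    by (subst lborel_eq, subst nn_integral_distr) auto
  also have "\<dots> = (\<integral>\<^sup>+x. (\<integral>\<^sup>+y. f (?T (x(e := y)) + (?T (x(e := y)) \<bullet> e') *\<^sub>R e) \<partial>lborel) \<partial>(\<Pi>\<^sub>M b\<in>?I. lborel))"
    by (rule fold[of "\<lambda>z. f (z + (z \<bullet> e') *\<^sub>R e)"]) measurable
  also have "\<dots> = (\<integral>\<^sup>+x. (\<integral>\<^sup>+y. f (?T (x(e := y))) \<partial>lborel) \<partial>(\<Pi>\<^sub>M b\<in>?I. lborel))"
  proof (rule nn_integral_cong, goal_cases)
    case (1 x)
    have "?T (x(e := y)) + (?T (x(e := y)) \<bullet> e') *\<^sub>R e = ?T (x(e := x e' + y))" for y
    proof -
      have split: "?T (x(e := z)) = z *\<^sub>R e + (\<Sum>b\<in>?I. x b *\<^sub>R b)" for z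
        using e by (subst sum.remove[of _ e]) (auto intro!: sum.cong)
      have "?T (x(e := y)) \<bullet> e' = x e'"
        using e by (simp add: inner_sum_left_Basis)
      then show ?thesis
        by (simp only: split) (simp add: algebra_simps)
    qed
    moreover have "(\<lambda>y. ?T (x(e := y))) \<in> borel \<rightarrow>\<^sub>M borel"
      unfolding fun_upd_apply by measurable
    from measurable_compose[OF this, of f borel]
    have "(\<integral>\<^sup>+y. f (?T (x(e := x e' + y))) \<partial>lborel) = (\<integral>\<^sup>+y. f (?T (x(e := y))) \<partial>lborel)"
      by (intro nn_integral_lborel_plus[of "\<lambda>y. f (?T (x(e := y)))"]) simp
    ultimately show ?case by simp
  qed
  also have "\<dots> = (\<integral>\<^sup>+x. f (?T x) \<partial>?M)"
    by (rule fold[symmetric]) simp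
  also have "\<dots> = (\<integral>\<^sup>+x. f x \<partial>lborel)"
    by (subst lborel_eq, subst nn_integral_distr) auto
  finally show ?thesis .
qed

lemma Basis_vec_real: "(Basis :: (real^'n) set) = range (\<lambda>i. axis i 1)"
  by (auto simp: Basis_vec_def)

lemma prod_Basis_vec:
  "(\<Prod>b\<in>(Basis :: (real^'n) set). F b) = (\<Prod>i\<in>UNIV. F (axis i 1))"
  unfolding Basis_vec_real
  by (subst prod.reindex) (auto simp: inj_on_def axis_eq_axis)

lemma sum_Basis_vec:
  "(\<Sum>b\<in>(Basis :: (real^'n) set). F b) = (\<Sum>i\<in>UNIV. F (axis i 1))"
  unfolding Basis_vec_real
  by (subst sum.reindex) (auto simp: inj_on_def axis_eq_axis)

lemma borel_measurable_matrix_vector_mult[measurable]: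
  "(\<lambda>x. (M :: real^'n^'m) *v x) \<in> borel_measurable borel"
  by (intro borel_measurable_continuous_onI linear_continuous_on
      linear_linear[THEN iffD2] matrix_vector_mul_linear)

text \<open>The preimage of a box is a box with permuted side lengths, hence of equal volume;
  \<open>lborel_eqI\<close> says that box volumes determine Lebesgue measure.\<close>

lemma nn_integral_lborel_permute:
  fixes f :: "real^'n \<Rightarrow> ennreal" and p :: "'n \<Rightarrow> 'n"
  assumes [measurable]: "f \<in> borel_measurable borel" and p: "bij p"
  shows "(\<integral>\<^sup>+x. f (\<chi> i. x $ p i) \<partial>lborel) = (\<integral>\<^sup>+x. f x \<partial>lborel)"
proof -
  have lin: "linear (\<lambda>x::real^'n. \<chi> i. x $ p i)"
    by (rule linearI) (auto simp: vec_eq_iff)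
  have [measurable]: "(\<lambda>x::real^'n. \<chi> i. x $ p i) \<in> borel \<rightarrow>\<^sub>M borel"
    using lin by (intro borel_measurable_continuous_onI linear_continuous_on) (simp add: linear_linear)
  have "lborel = distr lborel borel (\<lambda>x::real^'n. \<chi> i. x $ p i)"
  proof (rule lborel_eqI)
    fix l u :: "real^'n" assume le: "\<And>b. b \<in> Basis \<Longrightarrow> l \<bullet> b \<le> u \<bullet> b"
    let ?q = "inv p"
    have le': "l $ i \<le> u $ i" for i using le[of "axis i 1"] by (simp add: inner_axis Basis_vec_real)
    have eq: "(\<lambda>x. \<chi> i. x $ p i) -` box l u = box (\<chi> i. l $ ?q i) (\<chi> i. u $ ?q i)"
      using p by (auto simp: mem_box_cart) (metis bij_inv_eq_iff)+
    have "(\<Prod>b\<in>Basis. ((\<chi> i. u $ ?q i) - (\<chi> i. l $ ?q i)) \<bullet> b) = (\<Prod>i\<in>UNIV. u $ ?q i - l $ ?q i)"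
      by (simp add: prod_Basis_vec inner_axis)
    also have "\<dots> = (\<Prod>i\<in>UNIV. u $ i - l $ i)"
      by (rule prod.reindex_bij_betw[of ?q UNIV UNIV "\<lambda>i. u $ i - l $ i"]) (simp add: p bij_imp_bij_inv)
    also have "\<dots> = (\<Prod>b\<in>Basis. (u - l) \<bullet> b)"
      by (simp add: prod_Basis_vec inner_axis)
    finally have *: "(\<Prod>b\<in>Basis. ((\<chi> i. u $ ?q i) - (\<chi> i. l $ ?q i)) \<bullet> b) = (\<Prod>b\<in>Basis. (u - l) \<bullet> b)" .
    show "emeasure (distr lborel borel (\<lambda>x. \<chi> i. x $ p i)) (box l u) = (\<Prod>b\<in>Basis. (u - l) \<bullet> b)"
    proof -
      have "(\<chi> i. l $ ?q i) \<bullet> b \<le> (\<chi> i. u $ ?q i) \<bullet> b" if "b \<in> Basis" for b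
        using that le' by (auto simp: Basis_vec_real inner_axis)
      then show ?thesis
        unfolding *[symmetric] by (subst emeasure_distr) (simp_all add: eq emeasure_lborel_box)
    qed
  qed simp
  then show ?thesis
    using nn_integral_distr[of "\<lambda>x::real^'n. \<chi> i. x $ p i" lborel borel f] by simp
qed

lemma nn_integral_lborel_diagonal:
  fixes f :: "real^'n \<Rightarrow> ennreal"
  assumes [measurable]: "f \<in> borel_measurable borel" and c: "\<And>i. c i \<noteq> 0"
  shows "ennreal \<bar>\<Prod>i\<in>UNIV. c i\<bar> * (\<integral>\<^sup>+x. f (\<chi> i. c i * x $ i) \<partial>lborel) = (\<integral>\<^sup>+x. f x \<partial>lborel)"
proof -
  \<comment> \<open>The library fact on axis scalings takes factors indexed by basis vectors, not by
    coordinates. \<open>axis\<close> is injective in the index, so the description picks a unique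
    one.\<close>
  define c' where "c' b = c (THE i. b = axis i (1::real))" for b :: "real^'n"
  have c': "c' (axis i 1) = c i" for i by (simp add: c'_def axis_eq_axis)
  have T: "0 + (\<Sum>j\<in>Basis. (c' j * (x \<bullet> j)) *\<^sub>R j) = (\<chi> i. c i * x $ i)" for x :: "real^'n"
    by (simp add: sum_Basis_vec c' inner_axis) (simp add: vec_eq_iff axis_def if_distrib cong: if_cong)
  have "lborel = density (distr lborel borel (\<lambda>x. \<chi> i. c i * x $ i)) (\<lambda>_. ennreal \<bar>\<Prod>i\<in>UNIV. c i\<bar>)"
  proof -
    have "c' j \<noteq> 0" if "j \<in> Basis" for j using that c by (auto simp: Basis_vec_real c')
    from lborel_affine_euclidean[of c' 0, OF this] show ?thesis
      unfolding T by (simp add: prod_Basis_vec c' abs_prod)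
  qed
  then have "(\<integral>\<^sup>+x. f x \<partial>lborel) = (\<integral>\<^sup>+x. f x \<partial>density (distr lborel borel (\<lambda>x. \<chi> i. c i * x $ i)) (\<lambda>_. ennreal \<bar>\<Prod>i\<in>UNIV. c i\<bar>))"
    by simp
  also have "\<dots> = ennreal \<bar>\<Prod>i\<in>UNIV. c i\<bar> * (\<integral>\<^sup>+x. f (\<chi> i. c i * x $ i) \<partial>lborel)"
  proof -
    have [measurable]: "(\<lambda>x::real^'n. \<chi> i. c i * x $ i) \<in> borel \<rightarrow>\<^sub>M borel"
      by (intro borel_measurable_continuous_onI linear_continuous_on linear_linear[THEN iffD2] linearI)
        (auto simp: vec_eq_iff algebra_simps)
    show ?thesis
      by (simp add: nn_integral_density nn_integral_distr nn_integral_cmult)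
  qed
  finally show ?thesis by simp
qed

text \<open>The change-of-variables theorems of HOL-Analysis require a well-ordered index type;
  the statement below does not.\<close>

lemma nn_integral_lborel_linear:
  fixes M :: "real^'n^'n"
  assumes "det M \<noteq> 0" and "f \<in> borel_measurable borel"
  shows "ennreal \<bar>det M\<bar> * (\<integral>\<^sup>+x. f (M *v x) \<partial>lborel) = (\<integral>\<^sup>+x. f x \<partial>lborel)"
proof -
  \<comment> \<open>Elementary matrices generate all square matrices. Quantifying over
    \<open>f\<close> inside \<open>?P\<close> lets the product case use the hypothesis for
    \<open>B\<close> at \<open>f\<close> composed with \<open>A\<close>; the guard on the
    determinant makes the zero-row case vacuous.\<close>
  let ?P = "\<lambda>M::real^'n^'n. det M \<noteq> 0 \<longrightarrow> (\<forall>f\<in>borel_measurable borel.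
      ennreal \<bar>det M\<bar> * (\<integral>\<^sup>+x. f (M *v x) \<partial>lborel) = (\<integral>\<^sup>+x. f x \<partial>lborel))"
  have "?P M"
  proof (rule induct_matrix_elementary_alt[of ?P])
    fix A B :: "real^'n^'n" assume A: "?P A" and B: "?P B"
    show "?P (A ** B)"
    proof (intro impI ballI)
      fix f :: "real^'n \<Rightarrow> ennreal"
      assume d: "det (A ** B) \<noteq> 0" and [measurable]: "f \<in> borel_measurable borel"
      have "(\<lambda>x. f (A *v x)) \<in> borel_measurable borel" by measurable
      moreover have "det A \<noteq> 0" "det B \<noteq> 0" using d by (auto simp: det_mul)
      ultimately have "ennreal \<bar>det A\<bar> * (ennreal \<bar>det B\<bar> * (\<integral>\<^sup>+x. f (A *v (B *v x)) \<partial>lborel)) = (\<integral>\<^sup>+x. f x \<partial>lborel)"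
        using A B[rule_format, of "\<lambda>x. f (A *v x)"] by simp
      then show "ennreal \<bar>det (A ** B)\<bar> * (\<integral>\<^sup>+x. f ((A ** B) *v x) \<partial>lborel) = (\<integral>\<^sup>+x. f x \<partial>lborel)"
        by (simp add: det_mul abs_mult ennreal_mult matrix_vector_mul_assoc mult.assoc)
    qed
  next
    fix A :: "real^'n^'n" and i assume "row i A = 0"
    then show "?P A" using det_zero_row(2) by blast
  next
    fix A :: "real^'n^'n" assume A: "\<And>i j. i \<noteq> j \<Longrightarrow> A $ i $ j = 0"
    have mv: "A *v x = (\<chi> i. A $ i $ i * x $ i)" for x
    proof -
      have "(A *v x) $ i = (\<Sum>j\<in>UNIV. if j = i then A $ i $ i * x $ i else 0)" for i
        unfolding matrix_vector_mult_def vec_lambda_beta by (intro sum.cong) (auto simp: A)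
      then show ?thesis by (simp add: vec_eq_iff)
    qed
    show "?P A"
      using nn_integral_lborel_diagonal[of _ "\<lambda>i. A $ i $ i"] by (auto simp: det_diagonal[OF A] mv)
  next
    fix m n :: 'n assume "m \<noteq> n"
    let ?S = "\<chi> i j. mat 1 $ i $ Transposition.transpose m n j :: real^'n^'n"
    have p: "Transposition.transpose m n permutes UNIV" by (simp add: permutes_swap_id)
    have "\<bar>det ?S\<bar> = 1"
      by (subst det_permute_columns[OF p]) (simp add: abs_mult sign_def)
    moreover have "?S *v x = (\<chi> i. x $ Transposition.transpose m n i)" for x
    proof -
      have "i = Transposition.transpose m n j \<longleftrightarrow> j = Transposition.transpose m n i" for i j
        by (metis transpose_involutory)
      then have "(?S *v x) $ i = (\<Sum>j\<in>UNIV. if j = Transposition.transpose m n i then x $ j else 0)" for i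
        unfolding matrix_vector_mult_def vec_lambda_beta mat_def by (intro sum.cong) auto
      then show ?thesis by (simp add: vec_eq_iff)
    qed
    ultimately show "?P ?S"
      using nn_integral_lborel_permute[of _ "Transposition.transpose m n"] by auto
  next
    fix m n :: 'n assume mn: "m \<noteq> n"
    let ?S = "\<chi> i j. of_bool (i = m \<and> j = n \<or> i = j) :: real^'n^'n"
    have "?S = (\<chi> k. if k = m then row m (mat 1) + 1 *s row n (mat 1) else row k (mat 1))"
      using mn by (auto simp: vec_eq_iff row_def mat_def)
    then have "det ?S = 1" using det_row_operation[OF mn, of "mat 1" 1] by simp
    moreover have "?S *v x = x + (x \<bullet> axis n 1) *\<^sub>R axis m 1" for x
    proof -
      have "(?S *v x) $ i = (\<Sum>j\<in>UNIV. (if j = i then x $ j else 0) + (if j = n then (if i = m then x $ j else 0) else 0))" for i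
        unfolding matrix_vector_mult_def using mn by (auto intro!: sum.cong)
      then show ?thesis by (simp add: vec_eq_iff sum.distrib inner_axis) (simp add: axis_def)
    qed
    ultimately show "?P ?S"
      using nn_integral_lborel_shear[of _ "axis m 1" "axis n (1::real)"] mn
      by (auto simp: Basis_vec_real axis_eq_axis)
  qed
  with assms show ?thesis by blast
qed

section \<open>A maximum principle for one-sided fractional integrals\<close>

lemma nn_integral_powr_atLeast:
  fixes s t :: real
  assumes "0 < s" "0 < t"
  shows "(\<integral>\<^sup>+u. ennreal (indicator {t..} u * u powr (-1 - s)) \<partial>lborel) = ennreal (t powr (- s) / s)"
  using nn_integral_has_integral_lebesgue[OF _ has_integral_powr_to_inf[of "-1 - s" t]] assms by simp

lemma nn_integral_powr_from_0:
  fixes e t :: real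
  assumes "-1 < e" "0 \<le> t"
  shows "(\<integral>\<^sup>+u. ennreal (indicator {0..t} u * u powr e) \<partial>lborel) = ennreal (t powr (e + 1) / (e + 1))"
  using nn_integral_has_integral_lebesgue[OF _ has_integral_powr_from_0[of e t]] assms by simp

text \<open>The maximum point on [0,t] is not known beforehand, so integrability and the lower bound
  by \<open>- G\<close> are demanded at every \<tau> before \<open>t\<close>. Only one of these
  points is used in the end.\<close>

lemma fractional_maximum_principle:
  fixes a :: "real \<Rightarrow> real"
  assumes s: "0 < s" and t: "0 < t" and cont: "continuous_on {0..t} a"
    and far: "\<And>\<sigma>. t \<le> \<sigma> \<Longrightarrow> a \<sigma> \<le> S"
    and int: "\<And>\<tau>. \<tau> \<in> {0..<t} \<Longrightarrow> set_integrable lborel {0<..} (\<lambda>u. u powr (-1 - s) * (a (\<tau> + u) - a \<tau>))"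
    and lower: "\<And>\<tau>. \<tau> \<in> {0..<t} \<Longrightarrow> - G \<le> (LINT u:{0<..}|lborel. u powr (-1 - s) * (a (\<tau> + u) - a \<tau>))"
    and G: "0 \<le> G"
  shows "a 0 \<le> S + s * t powr s * G"
proof -
  obtain \<tau> where \<tau>: "\<tau> \<in> {0..t}" and max: "\<And>x. x \<in> {0..t} \<Longrightarrow> a x \<le> a \<tau>"
    using continuous_attains_sup[OF compact_Icc _ cont] t by auto
  show ?thesis
  proof (cases "a \<tau> \<le> S")
    case True
    then show ?thesis using max[of 0] t s G by (smt (verit) atLeastAtMost_iff mult_nonneg_nonneg powr_ge_zero)
  next
    case False
    \<comment> \<open>\<open>\<tau>\<close> is then a global maximum point, so the integrand is nonpositive, and at most \<open>S - a \<tau>\<close> times the weight for \<open>u \<ge> t\<close>.\<close>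
    with far[of \<tau>] \<tau> have \<tau>': "\<tau> \<in> {0..<t}" by force
    have top: "a (\<tau> + u) \<le> a \<tau>" if "0 < u" for u
      using that max[of "\<tau> + u"] far[of "\<tau> + u"] False \<tau> by (cases "\<tau> + u \<le> t") auto
    have hb: "has_bochner_integral lborel (\<lambda>u. indicator {t..} u *\<^sub>R u powr (-1 - s)) (t powr (- s) / s)"
      using nn_integral_powr_atLeast[OF s t] s t
      by (intro has_bochner_integral_nn_integral) (auto simp: mult.commute)
    let ?I = "LINT u:{0<..}|lborel. u powr (-1 - s) * (a (\<tau> + u) - a \<tau>)"
    have "?I \<le> (LINT u|lborel. (S - a \<tau>) * (indicator {t..} u *\<^sub>R u powr (-1 - s)))"
      unfolding set_lebesgue_integral_def
    proof (rule integral_mono)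
      show "integrable lborel (\<lambda>u. indicator {0<..} u *\<^sub>R (u powr (-1 - s) * (a (\<tau> + u) - a \<tau>)))"
        using int[OF \<tau>'] by (simp add: set_integrable_def)
      show "integrable lborel (\<lambda>u. (S - a \<tau>) * (indicator {t..} u *\<^sub>R u powr (-1 - s)))"
        using hb by (intro integrable_mult_right) (auto simp: has_bochner_integral_iff)
      fix u :: real
      show "indicator {0<..} u *\<^sub>R (u powr (-1 - s) * (a (\<tau> + u) - a \<tau>)) \<le> (S - a \<tau>) * (indicator {t..} u *\<^sub>R u powr (-1 - s))"
      proof (cases "t \<le> u")
        case True
        then have "a (\<tau> + u) \<le> S" using far \<tau> by auto
        then have "u powr (-1 - s) * (a (\<tau> + u) - a \<tau>) \<le> u powr (-1 - s) * (S - a \<tau>)"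
          by (intro mult_left_mono) auto
        then show ?thesis using True t by (simp add: mult.commute)
      next
        case False
        then show ?thesis using top[of u] by (auto simp: indicator_def mult_nonneg_nonpos)
      qed
    qed
    also have "\<dots> = (S - a \<tau>) * (t powr (- s) / s)"
      using hb by (simp add: has_bochner_integral_iff)
    finally have "- G \<le> - ((a \<tau> - S) * (t powr (- s) / s))"
      using lower[OF \<tau>'] by (simp only: minus_mult_left minus_diff_eq)
    then have "a \<tau> - S \<le> s * t powr s * G"
      using s t by (simp add: powr_minus field_simps)
    then show ?thesis using max[of 0] t by auto
  qed
qed

section \<open>Positive definite matrices\<close>

lemma transpose_scaleR_matrix: "transpose (c *\<^sub>R A) = c *\<^sub>R transpose (A :: real^'n^'m)"
  by (simp add: vec_eq_iff transpose_def)

lemma transpose_add_matrix: "transpose (A + B) = transpose A + transpose (B :: real^'n^'m)"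
  by (simp add: vec_eq_iff transpose_def)

text \<open>\<open>matrix_inv\<close> is a choice among two-sided inverses. For square matrices a
  right inverse is two-sided, so a candidate exists, and associativity forces the chosen one to
  equal it.\<close>

lemma matrix_inv_eqI:
  fixes A :: "real^'n^'n"
  assumes "A ** B = mat 1"
  shows "matrix_inv A = B"
proof -
  have BA: "B ** A = mat 1" using assms matrix_left_right_inverse by blast
  have "A ** matrix_inv A = mat 1"
    unfolding matrix_inv_def by (rule someI2[of _ B]) (use assms BA in auto)
  then have "B ** (A ** matrix_inv A) = B" by simp
  then show ?thesis by (simp add: matrix_mul_assoc BA)
qed

lemma matrix_inv_right:
  fixes A :: "real^'n^'n"
  assumes "det A \<noteq> 0"
  shows "A ** matrix_inv A = mat 1"
  using assms invertible_det_nz invertible_right_inverse matrix_inv_eqI by metis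

lemma matrix_inv_left:
  fixes A :: "real^'n^'n"
  assumes "det A \<noteq> 0"
  shows "matrix_inv A ** A = mat 1"
  using matrix_inv_right[OF assms] matrix_left_right_inverse by blast

lemma matrix_inv_transpose:
  fixes A :: "real^'n^'n"
  assumes "det A \<noteq> 0"
  shows "matrix_inv (transpose A) = transpose (matrix_inv A)"
  by (rule matrix_inv_eqI)
    (simp add: matrix_inv_left[OF assms] flip: matrix_transpose_mul)

lemma matrix_inv_mul:
  fixes A B :: "real^'n^'n"
  assumes "det A \<noteq> 0" "det B \<noteq> 0"
  shows "matrix_inv (A ** B) = matrix_inv B ** matrix_inv A"
proof (rule matrix_inv_eqI)
  have "A ** B ** (matrix_inv B ** matrix_inv A) = A ** (B ** matrix_inv B) ** matrix_inv A"
    by (simp add: matrix_mul_assoc)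
  then show "A ** B ** (matrix_inv B ** matrix_inv A) = mat 1"
    by (simp add: matrix_inv_right assms)
qed

lemma det_matrix_inv:
  fixes A :: "real^'n^'n"
  assumes "det A \<noteq> 0"
  shows "det (matrix_inv A) = 1 / det A"
  using arg_cong[OF matrix_inv_right[OF assms], of det] assms by (simp add: det_mul field_simps)

text \<open>Gram-Schmidt for the inner product \<open>x \<bullet> (A *v y)\<close>, adding one
  vector at a time. Indexing by subsets of \<open>'n\<close> means that the final family, indexed by
  \<open>UNIV\<close>, can be read as the columns of a square matrix.\<close>

lemma pos_def_mat_orthonormal_family:
  fixes A :: "real^'n^'n" and S :: "'n set"
  assumes sym: "transpose A = A" and pd: "pos_def_mat A"
  shows "\<exists>b. \<forall>i\<in>S. \<forall>j\<in>S. b i \<bullet> (A *v b j) = (if i = j then 1 else 0)"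
proof (induction S rule: infinite_finite_induct)
  case (infinite S)
  then show ?case by simp
next
  case empty
  then show ?case by simp
next
  case (insert k S)
  then obtain b :: "'n \<Rightarrow> real^'n" where b: "\<And>i j. i \<in> S \<Longrightarrow> j \<in> S \<Longrightarrow> b i \<bullet> (A *v b j) = (if i = j then 1 else 0)"
    by blast
  let ?V = "(\<lambda>i. A *v b i) ` S"
  have "dim ?V \<le> card S"
    using dim_le_card'[of ?V] card_image_le[of S "\<lambda>i. A *v b i"] insert by auto
  \<comment> \<open>As \<open>k\<close> lies outside \<open>S\<close>, the vectors
    \<open>A *v b i\<close> cannot span the space; a nonzero \<open>v\<close> orthogonal to all of
    them is the next direction.\<close>
  also have "\<dots> < CARD('n)"
    using insert by (intro psubset_card_mono) auto
  finally have "dim ?V < DIM(real^'n)" by simp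
  then obtain v where v: "v \<noteq> 0" "\<And>y. y \<in> span ?V \<Longrightarrow> orthogonal v y"
    using orthogonal_to_subspace_exists by blast
  have vb: "v \<bullet> (A *v b i) = 0" if "i \<in> S" for i
    using v(2)[of "A *v b i"] that by (auto simp: orthogonal_def span_base)
  have bv: "b i \<bullet> (A *v v) = 0" if "i \<in> S" for i
    using vb[OF that] by (metis dot_lmul_matrix inner_commute sym transpose_matrix_vector)
  define q where "q = v \<bullet> (A *v v)"
  have q: "q > 0" using pd v(1) by (auto simp: pos_def_mat_def q_def)
  define w where "w = (1 / sqrt q) *\<^sub>R v"
  have Aw: "A *v w = (1 / sqrt q) *\<^sub>R (A *v v)" by (simp add: w_def matrix_vector_mult_scaleR)
  have "w \<bullet> (A *v w) = (1 / sqrt q) * (1 / sqrt q) * q"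
    unfolding Aw by (simp add: w_def q_def)
  also have "\<dots> = 1" using q by (simp add: field_simps)
  finally have "w \<bullet> (A *v w) = 1" .
  then have "\<forall>i\<in>insert k S. \<forall>j\<in>insert k S. (b(k := w)) i \<bullet> (A *v (b(k := w)) j) = (if i = j then 1 else 0)"
    using insert b vb bv Aw by (auto simp: w_def)
  then show ?case by blast
qed

lemma pos_def_mat_congruent_identity:
  fixes A :: "real^'n^'n"
  assumes sym: "transpose A = A" and pd: "pos_def_mat A"
  obtains M :: "real^'n^'n" where "transpose M ** A ** M = mat 1"
proof -
  obtain b :: "'n \<Rightarrow> real^'n" where b: "\<And>i j. b i \<bullet> (A *v b j) = (if i = j then 1 else 0)"
    using pos_def_mat_orthonormal_family[OF assms, of UNIV] by auto
  define M where "M = (\<chi> i j. b j $ i)"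
  have "(transpose M ** (A ** M)) $ i $ j = b i \<bullet> (A *v b j)" for i j
    by (simp add: matrix_matrix_mult_def matrix_vector_mult_def transpose_def M_def inner_vec_def)
  then have "transpose M ** A ** M = mat 1"
    by (simp add: vec_eq_iff b mat_def matrix_mul_assoc)
  then show ?thesis by (rule that)
qed

text \<open>Inverting the relation \<open>transpose L ** A ** L = mat 1\<close> gives the factor.
  The substitution \<open>w = M *v y\<close> then reduces integrals against any Gaussian to the
  standard one.\<close>

lemma pos_def_mat_factorization:
  fixes A :: "real^'n^'n"
  assumes sym: "transpose A = A" and pd: "pos_def_mat A"
  obtains M :: "real^'n^'n" where "A = M ** transpose M" "det M \<noteq> 0"
proof -
  obtain L :: "real^'n^'n" where L: "transpose L ** A ** L = mat 1"
    using pos_def_mat_congruent_identity[OF assms] .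
  have dL: "det L \<noteq> 0" using arg_cong[OF L, of det] by (auto simp: det_mul)
  define M where "M = matrix_inv (transpose L)"
  have dT: "det (transpose L) \<noteq> 0" using dL by simp
  have "M ** transpose M = M ** (transpose L ** A ** L) ** matrix_inv L"
    using dL by (simp add: L M_def matrix_inv_transpose)
  also have "\<dots> = (M ** transpose L) ** A ** (L ** matrix_inv L)"
    by (simp add: matrix_mul_assoc)
  finally have "A = M ** transpose M"
    using dL dT by (simp add: M_def matrix_inv_left matrix_inv_right)
  moreover have "det M \<noteq> 0" using det_matrix_inv[OF dT] dT by (simp add: M_def)
  ultimately show ?thesis by (rule that)
qed

lemma pos_def_mat_det_pos:
  fixes A :: "real^'n^'n"
  assumes "transpose A = A" "pos_def_mat A"
  shows "det A > 0"
  using pos_def_mat_factorization[OF assms]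
  by (metis det_mul det_transpose linorder_neqE_linordered_idom mult_neg_neg mult_pos_pos)

lemma pos_def_mat_add:
  "pos_def_mat A \<Longrightarrow> pos_def_mat B \<Longrightarrow> pos_def_mat (A + B)"
  by (auto simp: pos_def_mat_def matrix_vector_mult_add_rdistrib inner_add_right add_pos_pos)

lemma pos_def_mat_congruent:
  fixes A E :: "real^'n^'n"
  assumes "pos_def_mat A" "det E \<noteq> 0"
  shows "pos_def_mat (E ** A ** transpose E)"
  unfolding pos_def_mat_def
proof (intro allI impI)
  fix x :: "real^'n" assume x: "x \<noteq> 0"
  have "transpose E *v x \<noteq> 0"
  proof
    assume "transpose E *v x = 0"
    moreover have "matrix_inv (transpose E) *v (transpose E *v x) = x"
      using assms by (simp add: matrix_vector_mul_assoc matrix_inv_left del: transpose_matrix_vector)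
    ultimately show False using x by simp
  qed
  then have "(transpose E *v x) \<bullet> (A *v (transpose E *v x)) > 0"
    using assms by (simp add: pos_def_mat_def)
  then show "x \<bullet> ((E ** A ** transpose E) *v x) > 0"
    by (simp add: dot_lmul_matrix transpose_matrix_vector flip: matrix_vector_mul_assoc)
qed

text \<open>For symmetric \<open>A\<close> the inverse is congruent to \<open>A\<close>, with
  \<open>matrix_inv A\<close> itself as the congruence.\<close>

lemma pos_def_mat_inv:
  fixes A :: "real^'n^'n"
  assumes "transpose A = A" "pos_def_mat A"
  shows "pos_def_mat (matrix_inv A)"
proof -
  have d: "det A \<noteq> 0" using pos_def_mat_det_pos[OF assms] by simp
  have "matrix_inv A ** A ** transpose (matrix_inv A) = matrix_inv A"
    using d assms by (simp add: matrix_inv_left flip: matrix_inv_transpose)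
  then show ?thesis
    using pos_def_mat_congruent[OF assms(2), of "matrix_inv A"] d by (simp add: det_matrix_inv)
qed

section \<open>Gaussian densities\<close>

text \<open>The centred Gaussian density with covariance matrix \<open>2A\<close>. The factor 4 in
  the exponent is the normalisation of the heat kernel, which becomes \<open>gauss\<close> at the
  matrix tK(t).\<close>

definition gauss :: "real^'n^'n \<Rightarrow> real^'n \<Rightarrow> real" where
  "gauss A w = (4 * pi) powr (- real CARD('n) / 2) * det A powr (-1/2) * exp (- (w \<bullet> (matrix_inv A *v w)) / 4)"

lemma gauss_nonneg: "0 \<le> gauss A w"
  by (simp add: gauss_def)

lemma borel_measurable_gauss[measurable]: "gauss A \<in> borel_measurable borel"
  unfolding gauss_def by measurable

lemma nn_integral_exp_norm_sq:
  assumes "c > 0"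
  shows "(\<integral>\<^sup>+(y::real^'n). ennreal (exp (- ((norm y)\<^sup>2 / c))) \<partial>lborel) = ennreal ((c * pi) powr (real CARD('n) / 2))"
proof -
  have one: "(\<integral>\<^sup>+x. ennreal (exp (- (x\<^sup>2 / c))) \<partial>lborel) = ennreal (sqrt (c * pi))" (is "?L = _")
  proof -
    let ?\<sigma> = "sqrt (c / 2)"
    have sg: "?\<sigma> > 0" using assms by simp
    have nd: "exp (- (x\<^sup>2 / c)) = sqrt (c * pi) * normal_density 0 ?\<sigma> x" for x
      using assms by (simp add: normal_density_def field_simps)
    have "(\<integral>\<^sup>+x. ennreal (normal_density 0 ?\<sigma> x) \<partial>lborel) = 1"
      using sg by (subst nn_integral_eq_integral) (auto simp: normal_density_nonneg)
    then show ?thesis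
      using assms by (simp add: nd ennreal_mult normal_density_nonneg nn_integral_cmult)
  qed
  have "(norm y)\<^sup>2 = (\<Sum>b\<in>Basis. (y \<bullet> b)\<^sup>2)" for y :: "real^'n"
    by (subst power2_norm_eq_inner, subst euclidean_inner) (simp add: power2_eq_square)
  then have "ennreal (exp (- ((norm y)\<^sup>2 / c))) = (\<Prod>b\<in>Basis. ennreal (exp (- ((y \<bullet> b)\<^sup>2 / c))))" for y :: "real^'n"
    by (simp add: exp_sum[symmetric] prod_ennreal sum_negf sum_divide_distrib)
  then have "(\<integral>\<^sup>+(y::real^'n). ennreal (exp (- ((norm y)\<^sup>2 / c))) \<partial>lborel) = ennreal (sqrt (c * pi)) ^ CARD('n)"
    using nn_integral_lborel_prod[where 'a="real^'n" and f = "\<lambda>_ x. ennreal (exp (- (x\<^sup>2 / c)))"] by (simp add: one)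
  also have "\<dots> = ennreal ((c * pi) powr (real CARD('n) / 2))"
    using assms by (simp add: ennreal_power powr_half_sqrt[symmetric] powr_powr flip: powr_realpow)
  finally show ?thesis .
qed

text \<open>The quadratic form is invariant under \<open>w\<close> to \<open>E *v w\<close>, while
  the determinant under the power -1/2 picks up the square of \<open>det E\<close>, which the
  prefactor cancels.\<close>

lemma gauss_congruent:
  fixes A E :: "real^'n^'n"
  assumes A: "det A > 0" and E: "det E \<noteq> 0"
  shows "\<bar>det E\<bar> * gauss (E ** A ** transpose E) (E *v w) = gauss A w"
proof -
  have "matrix_inv (E ** A ** transpose E) = transpose (matrix_inv E) ** matrix_inv A ** matrix_inv E"
    using A E by (simp add: matrix_inv_mul matrix_inv_transpose det_mul matrix_mul_assoc)
  then have "(E *v w) \<bullet> (matrix_inv (E ** A ** transpose E) *v (E *v w)) =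
     (E *v w) \<bullet> (transpose (matrix_inv E) *v (matrix_inv A *v (matrix_inv E *v (E *v w))))"
    by (simp only: matrix_vector_mul_assoc matrix_mul_assoc)
  also have "\<dots> = (matrix_inv E *v (E *v w)) \<bullet> (matrix_inv A *v (matrix_inv E *v (E *v w)))"
    by (metis dot_lmul_matrix inner_commute transpose_matrix_vector)
  also have "matrix_inv E *v (E *v w) = w"
    by (simp add: matrix_vector_mul_assoc matrix_inv_left E)
  finally have q: "(E *v w) \<bullet> (matrix_inv (E ** A ** transpose E) *v (E *v w)) = w \<bullet> (matrix_inv A *v w)" .
  have "det (E ** A ** transpose E) = \<bar>det E\<bar>\<^sup>2 * det A"
    by (simp add: det_mul power2_eq_square)
  then have "det (E ** A ** transpose E) powr (-1/2) = (\<bar>det E\<bar>\<^sup>2) powr (-1/2) * det A powr (-1/2)"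
    using A by (simp add: powr_mult)
  also have "(\<bar>det E\<bar>\<^sup>2) powr (-1/2) = 1 / \<bar>det E\<bar>"
    using E by (simp add: powr_minus_divide powr_half_sqrt del: power2_abs)
  finally show ?thesis using E by (simp add: gauss_def q)
qed

lemma gauss_mat_1: "gauss (mat 1) (y :: real^'n) = (4 * pi) powr (- real CARD('n) / 2) * exp (- ((norm y)\<^sup>2 / 4))"
  by (simp add: gauss_def matrix_inv_eqI[of "mat 1" "mat 1"] power2_norm_eq_inner)

lemma nn_integral_gauss_substitution:
  fixes A M :: "real^'n^'n"
  assumes A: "A = M ** transpose M" and M: "det M \<noteq> 0" and [measurable]: "F \<in> borel_measurable borel"
  shows "(\<integral>\<^sup>+w. ennreal (gauss A w) * F w \<partial>lborel) = (\<integral>\<^sup>+y. ennreal (gauss (mat 1) y) * F (M *v y) \<partial>lborel)"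
proof -
  have "(\<integral>\<^sup>+w. ennreal (gauss A w) * F w \<partial>lborel) = ennreal \<bar>det M\<bar> * (\<integral>\<^sup>+y. ennreal (gauss A (M *v y)) * F (M *v y) \<partial>lborel)"
    by (rule nn_integral_lborel_linear[OF M, symmetric]) measurable
  also have "\<dots> = (\<integral>\<^sup>+y. ennreal (\<bar>det M\<bar> * gauss A (M *v y)) * F (M *v y) \<partial>lborel)"
    by (subst nn_integral_cmult[symmetric]) (auto simp: ennreal_mult gauss_nonneg mult.assoc)
  also have "\<dots> = (\<integral>\<^sup>+y. ennreal (gauss (mat 1) y) * F (M *v y) \<partial>lborel)"
    using gauss_congruent[of "mat 1" M] M by (simp add: A)
  finally show ?thesis .
qed

lemma nn_integral_gauss_mat_1: "(\<integral>\<^sup>+(y::real^'n). ennreal (gauss (mat 1) y) \<partial>lborel) = 1"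
proof -
  have "(\<integral>\<^sup>+(y::real^'n). ennreal (gauss (mat 1) y) \<partial>lborel) =
    ennreal ((4 * pi) powr (- real CARD('n) / 2)) * ennreal ((4 * pi) powr (real CARD('n) / 2))"
    unfolding gauss_mat_1 by (simp add: ennreal_mult nn_integral_cmult nn_integral_exp_norm_sq)
  then show ?thesis by (simp add: ennreal_mult[symmetric] powr_add[symmetric])
qed

lemma nn_integral_gauss:
  fixes A :: "real^'n^'n"
  assumes "transpose A = A" "pos_def_mat A"
  shows "(\<integral>\<^sup>+w. ennreal (gauss A w) \<partial>lborel) = 1"
proof -
  obtain M where M: "A = M ** transpose M" "det M \<noteq> 0"
    using pos_def_mat_factorization[OF assms] .
  show ?thesis
    using nn_integral_gauss_substitution[OF M, of "\<lambda>_. 1"] by (simp add: nn_integral_gauss_mat_1)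
qed

definition gauss_moment :: "'n::finite itself \<Rightarrow> ennreal" where
  "gauss_moment _ = (\<integral>\<^sup>+(y::real^'n). ennreal (gauss (mat 1) y) * ennreal (norm y) \<partial>lborel)"

lemma gauss_moment_finite: "gauss_moment TYPE('n::finite) < \<infinity>"
proof -
  have le: "gauss (mat 1) y * norm y \<le> 4 * exp (- ((norm y)\<^sup>2 / 8))" for y :: "real^'n"
  proof -
    \<comment> \<open>Half of the Gaussian exponent is spent on the factor \<open>norm y\<close>,
      leaving a Gaussian of known integral.\<close>
    have 1: "norm y \<le> 4 * exp ((norm y)\<^sup>2 / 8)"
    proof -
      have "norm y \<le> 4 * (1 + (norm y)\<^sup>2 / 8)"
        using zero_le_power2[of "norm y - 1"] by (simp add: power2_diff)
      also have "\<dots> \<le> 4 * exp ((norm y)\<^sup>2 / 8)" by (intro mult_left_mono exp_ge_add_one_self) simp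
      finally show ?thesis .
    qed
    have 2: "(4 * pi) powr (- real CARD('n) / 2) \<le> 1"
      using pi_ge_two by (simp add: powr_minus field_simps ge_one_powr_ge_zero)
    have "gauss (mat 1) y * norm y \<le> (1 * exp (- ((norm y)\<^sup>2 / 4))) * (4 * exp ((norm y)\<^sup>2 / 8))"
      unfolding gauss_mat_1 by (intro mult_mono 1 2) auto
    also have "\<dots> = 4 * exp (- ((norm y)\<^sup>2 / 8))" by (simp add: exp_add[symmetric])
    finally show ?thesis .
  qed
  have "gauss_moment TYPE('n) \<le> (\<integral>\<^sup>+(y::real^'n). ennreal (4 * exp (- ((norm y)\<^sup>2 / 8))) \<partial>lborel)"
    unfolding gauss_moment_def
    by (intro nn_integral_mono) (simp add: ennreal_mult[symmetric] gauss_nonneg ennreal_leI le)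
  also have "\<dots> < \<infinity>"
    by (simp add: ennreal_mult nn_integral_cmult nn_integral_exp_norm_sq ennreal_mult_less_top)
  finally show ?thesis .
qed

text \<open>Cauchy-Schwarz in each row; the trace is the sum of the squared row norms. Written
  through \<open>M ** transpose M\<close>, the bound depends on the matrix of the Gaussian and not
  on the factor chosen.\<close>

lemma norm_mult_vec_le_trace:
  fixes M :: "real^'n^'n"
  shows "norm (M *v y) \<le> sqrt (trace (M ** transpose M)) * norm y"
proof -
  have "(norm (M *v y))\<^sup>2 = (\<Sum>i\<in>UNIV. (row i M \<bullet> y)\<^sup>2)"
    by (simp add: norm_vec_def L2_set_def sum_nonneg matrix_vector_mult_def inner_vec_def row_def)
  also have "\<dots> \<le> (\<Sum>i\<in>UNIV. (row i M \<bullet> row i M) * (norm y)\<^sup>2)"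
    by (intro sum_mono) (simp add: Cauchy_Schwarz_ineq power2_norm_eq_inner)
  also have "\<dots> = trace (M ** transpose M) * (norm y)\<^sup>2"
    by (simp add: sum_distrib_right trace_def matrix_matrix_mult_def transpose_def inner_vec_def row_def)
  finally show ?thesis
    by (metis norm_ge_zero real_le_rsqrt real_sqrt_abs abs_norm_cancel real_sqrt_mult)
qed

text \<open>This is where the exponent 1/2 comes from: the trace of the covariance at time
  \<open>u\<close> is O(u), so the mean displacement is of order \<open>sqrt u\<close>.\<close>

lemma nn_integral_gauss_norm:
  fixes A :: "real^'n^'n"
  assumes "transpose A = A" "pos_def_mat A"
  shows "(\<integral>\<^sup>+w. ennreal (gauss A w) * ennreal (norm w) \<partial>lborel) \<le> ennreal (sqrt (trace A)) * gauss_moment TYPE('n)"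
proof -
  obtain M where M: "A = M ** transpose M" "det M \<noteq> 0"
    using pos_def_mat_factorization[OF assms] .
  have "(\<integral>\<^sup>+w. ennreal (gauss A w) * ennreal (norm w) \<partial>lborel) = (\<integral>\<^sup>+y. ennreal (gauss (mat 1) y) * ennreal (norm (M *v y)) \<partial>lborel)"
    by (rule nn_integral_gauss_substitution[OF M]) simp
  also have "\<dots> \<le> (\<integral>\<^sup>+(y::real^'n). ennreal (sqrt (trace A)) * (ennreal (gauss (mat 1) y) * ennreal (norm y)) \<partial>lborel)"
  proof (intro nn_integral_mono)
    fix y :: "real^'n"
    have tr: "0 \<le> trace A" unfolding M by (simp add: trace_def matrix_matrix_mult_def transpose_def sum_nonneg)
    have "gauss (mat 1) y * norm (M *v y) \<le> sqrt (trace A) * (gauss (mat 1) y * norm y)"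
      using mult_left_mono[OF norm_mult_vec_le_trace[of M y] gauss_nonneg[of "mat 1" y]]
      by (simp add: M ac_simps)
    then show "ennreal (gauss (mat 1) y) * ennreal (norm (M *v y)) \<le> ennreal (sqrt (trace A)) * (ennreal (gauss (mat 1) y) * ennreal (norm y))"
      using tr by (simp add: ennreal_mult[symmetric] gauss_nonneg ennreal_leI)
  qed
  also have "\<dots> = ennreal (sqrt (trace A)) * gauss_moment TYPE('n)"
    unfolding gauss_moment_def by (rule nn_integral_cmult) measurable
  finally show ?thesis .
qed

lemma matrix_add_rdistrib: "(A + B) ** C = A ** C + B ** (C :: real^'n^'m)" for A B :: "real^'m^'k"
  by (simp add: vec_eq_iff matrix_matrix_mult_def sum.distrib distrib_right)

text \<open>Completing the square in \<open>z\<close>. The part depending on \<open>z\<close> is a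
  Gaussian with matrix \<open>matrix_inv H\<close> and a centre linear in \<open>y\<close>; what is
  left depends on \<open>y\<close> alone and is the Gaussian of \<open>A + B\<close>.\<close>

lemma gauss_mult_gauss:
  fixes A B :: "real^'n^'n"
  assumes A: "transpose A = A" "pos_def_mat A" and B: "transpose B = B" "pos_def_mat B"
  defines "H \<equiv> matrix_inv A + matrix_inv B"
  shows "gauss A z * gauss B (y - z) = gauss (A + B) y * gauss (matrix_inv H) (z - matrix_inv H *v (matrix_inv B *v y))"
proof -
  let ?a = "matrix_inv A" and ?b = "matrix_inv B" and ?S = "matrix_inv (A + B)"
  have AB: "transpose (A + B) = A + B" "pos_def_mat (A + B)"
    using A B by (auto simp: transpose_add_matrix pos_def_mat_add)
  have pA: "det A > 0" and pB: "det B > 0" and pAB: "det (A + B) > 0"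
    using pos_def_mat_det_pos A B AB by blast+
  have dA: "det A \<noteq> 0" and dB: "det B \<noteq> 0" and dAB: "det (A + B) \<noteq> 0" using pA pB pAB by auto
  \<comment> \<open>This product form yields both the determinant and the inverse of
    \<open>H\<close>.\<close>
  have H: "H = ?a ** (A + B) ** ?b"
    using dA dB
    by (simp add: H_def matrix_add_ldistrib matrix_add_rdistrib matrix_inv_left add.commute)
      (simp add: matrix_inv_right flip: matrix_mul_assoc)
  have detH: "det H = det (A + B) / (det A * det B)"
    using dA dB by (simp add: H det_mul det_matrix_inv)
  then have dH: "det H \<noteq> 0" using dA dB dAB by simp
  have iH: "matrix_inv H = B ** ?S ** A"
  proof (rule matrix_inv_eqI)
    have "H ** (B ** ?S ** A) = ?a ** ((A + B) ** ((?b ** B) ** ?S)) ** A"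
      by (simp add: H matrix_mul_assoc)
    then show "H ** (B ** ?S ** A) = mat 1"
      by (simp add: matrix_inv_left matrix_inv_right dA dB dAB)
  qed
  \<comment> \<open>A Woodbury identity: it splits the form of the inverse of \<open>B\<close> at
    \<open>y\<close> into the form of the inverse of \<open>A + B\<close> and the constant produced
    by completing the square.\<close>
  have key: "?b = ?S + ?b ** matrix_inv H ** ?b"
  proof -
    have "?S + ?b ** matrix_inv H ** ?b = ?S ** (B ** ?b) + (?b ** B) ** ?S ** A ** ?b"
      by (simp add: iH matrix_mul_assoc matrix_inv_right dB)
    also have "\<dots> = ?S ** (A + B) ** ?b"
      by (simp add: matrix_inv_left dB matrix_add_ldistrib matrix_add_rdistrib matrix_mul_assoc add.commute)
    finally show ?thesis by (simp add: matrix_inv_left dAB)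
  qed
  have iiH: "matrix_inv (matrix_inv H) = H"
    by (rule matrix_inv_eqI) (simp add: matrix_inv_left dH)
  have sb: "transpose ?b = ?b" using B dB by (simp flip: matrix_inv_transpose)
  have sH: "transpose H = H"
    using A B dA dB by (simp add: H_def transpose_add_matrix flip: matrix_inv_transpose)
  have swap: "u \<bullet> (S *v v) = v \<bullet> (S *v u)" if "transpose S = S" for S :: "real^'n^'n" and u v
    by (metis dot_lmul_matrix inner_commute transpose_matrix_vector that)
  let ?c = "matrix_inv H *v (?b *v y)"
  have Hc: "H *v ?c = ?b *v y" by (simp add: matrix_vector_mul_assoc matrix_mul_assoc matrix_inv_right dH)
  have "(z - ?c) \<bullet> (H *v (z - ?c)) = z \<bullet> (H *v z) - 2 * (z \<bullet> (?b *v y)) + ?c \<bullet> (?b *v y)"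
    using swap[OF sH, of ?c z] by (simp add: matrix_vector_mult_diff_distrib inner_diff_left inner_diff_right Hc)
  moreover have "(y - z) \<bullet> (?b *v (y - z)) = y \<bullet> (?b *v y) - 2 * (z \<bullet> (?b *v y)) + z \<bullet> (?b *v z)"
    using swap[OF sb, of y z] by (simp add: matrix_vector_mult_diff_distrib inner_diff_left inner_diff_right)
  moreover have "z \<bullet> (H *v z) = z \<bullet> (?a *v z) + z \<bullet> (?b *v z)"
    by (simp add: H_def matrix_vector_mult_add_rdistrib inner_add_right)
  moreover have "y \<bullet> (?b *v y) = y \<bullet> (?S *v y) + ?c \<bullet> (?b *v y)"
  proof -
    have "y \<bullet> (?b *v y) = y \<bullet> (?S *v y) + y \<bullet> (?b *v ?c)"
      by (subst key) (simp add: matrix_vector_mult_add_rdistrib inner_add_right matrix_vector_mul_assoc matrix_mul_assoc)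
    then show ?thesis using swap[OF sb, of y ?c] by simp
  qed
  ultimately have quad: "z \<bullet> (?a *v z) + (y - z) \<bullet> (?b *v (y - z)) = y \<bullet> (?S *v y) + (z - ?c) \<bullet> (H *v (z - ?c))"
    by linarith
  have "det (matrix_inv H) = det A * det B / det (A + B)"
    using dH by (simp add: det_matrix_inv detH)
  then have "det (A + B) powr (-1/2) * det (matrix_inv H) powr (-1/2) = (det A * det B) powr (-1/2)"
    using pA pB pAB by (simp flip: powr_mult)
  also have "\<dots> = det A powr (-1/2) * det B powr (-1/2)"
    using pA pB by (simp add: powr_mult)
  finally have dets: "det (A + B) powr (-1/2) * det (matrix_inv H) powr (-1/2) = det A powr (-1/2) * det B powr (-1/2)" .
  let ?k = "(4 * pi) powr (- real CARD('n) / 2)"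
  have "gauss A z * gauss B (y - z) = ?k * ?k * (det A powr (-1/2) * det B powr (-1/2))
      * exp (- (z \<bullet> (?a *v z) + (y - z) \<bullet> (?b *v (y - z))) / 4)"
    by (simp add: gauss_def exp_add[symmetric] add_divide_distrib)
  also have "\<dots> = gauss (A + B) y * gauss (matrix_inv H) (z - ?c)"
    unfolding quad dets[symmetric] gauss_def iiH by (simp add: exp_add[symmetric] add_divide_distrib)
  finally show ?thesis .
qed

lemma gauss_convolution:
  fixes A B :: "real^'n^'n"
  assumes A: "transpose A = A" "pos_def_mat A" and B: "transpose B = B" "pos_def_mat B"
  shows "(\<integral>\<^sup>+z. ennreal (gauss A z) * ennreal (gauss B (y - z)) \<partial>lborel) = ennreal (gauss (A + B) y)"
proof -
  define H where "H = matrix_inv A + matrix_inv B"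
  let ?c = "matrix_inv H *v (matrix_inv B *v y)"
  have dA: "det A \<noteq> 0" and dB: "det B \<noteq> 0"
    using pos_def_mat_det_pos[OF A] pos_def_mat_det_pos[OF B] by auto
  have H: "transpose H = H" "pos_def_mat H"
    using A B dA dB pos_def_mat_inv[OF A] pos_def_mat_inv[OF B]
    by (auto simp: H_def transpose_add_matrix pos_def_mat_add simp flip: matrix_inv_transpose)
  have dH: "det H \<noteq> 0" using pos_def_mat_det_pos[OF H] by auto
  have iH: "transpose (matrix_inv H) = matrix_inv H" "pos_def_mat (matrix_inv H)"
    using H dH pos_def_mat_inv[OF H] by (auto simp flip: matrix_inv_transpose)
  have "(\<integral>\<^sup>+z. ennreal (gauss A z) * ennreal (gauss B (y - z)) \<partial>lborel)
      = (\<integral>\<^sup>+z. ennreal (gauss (A + B) y) * ennreal (gauss (matrix_inv H) (- ?c + z)) \<partial>lborel)"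
    using gauss_mult_gauss[OF A B, folded H_def]
    by (simp add: ennreal_mult[symmetric] gauss_nonneg)
  also have "\<dots> = ennreal (gauss (A + B) y) * (\<integral>\<^sup>+z. ennreal (gauss (matrix_inv H) (- ?c + z)) \<partial>lborel)"
    by (rule nn_integral_cmult) measurable
  also have "(\<integral>\<^sup>+z. ennreal (gauss (matrix_inv H) (- ?c + z)) \<partial>lborel) = 1"
    using nn_integral_lborel_plus[of "\<lambda>z. ennreal (gauss (matrix_inv H) z)" "- ?c"] nn_integral_gauss[OF iH] by simp
  finally show ?thesis by simp
qed

section \<open>The matrix exponential\<close>

lemma mpow_scaleR: "mpow (t *\<^sub>R B) k = t ^ k *\<^sub>R mpow B k"
proof (induction k)
  case (Suc k)
  have "t *\<^sub>R B ** (c *\<^sub>R M) = (t * c) *\<^sub>R (B ** M)" for c and M :: "real^'a^'a"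
    by (simp add: vec_eq_iff matrix_matrix_mult_def sum_distrib_left ac_simps)
  then show ?case by (simp add: Suc)
qed simp

lemma mpow_add: "mpow B (a + b) = mpow B a ** mpow B b"
  by (induction a) (auto simp: matrix_mul_assoc)

lemma mpow_component_le: "\<bar>mpow B k $ i $ j\<bar> \<le> (\<Sum>i\<in>UNIV. \<Sum>j\<in>UNIV. \<bar>B $ i $ j\<bar>) ^ k"
proof (induction k arbitrary: i j)
  case 0
  then show ?case by (simp add: mat_def)
next
  case (Suc k)
  let ?c = "\<Sum>i\<in>UNIV. \<Sum>j\<in>UNIV. \<bar>B $ i $ j\<bar>"
  have c: "0 \<le> ?c" by (intro sum_nonneg) auto
  have "\<bar>mpow B (Suc k) $ i $ j\<bar> \<le> (\<Sum>l\<in>UNIV. \<bar>B $ i $ l * mpow B k $ l $ j\<bar>)"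
    by (simp add: matrix_matrix_mult_def)
  also have "\<dots> \<le> (\<Sum>l\<in>UNIV. \<bar>B $ i $ l\<bar> * ?c ^ k)"
    unfolding abs_mult by (intro sum_mono mult_left_mono Suc) auto
  also have "\<dots> = (\<Sum>l\<in>UNIV. \<bar>B $ i $ l\<bar>) * ?c ^ k"
    by (simp add: sum_distrib_right)
  also have "\<dots> \<le> ?c * ?c ^ k"
    using c by (intro mult_right_mono member_le_sum) (auto intro: sum_nonneg)
  finally show ?case by simp
qed

text \<open>Each entry of \<open>mexp (t *\<^sub>R B)\<close> is a scalar power series in
  \<open>t\<close> with these coefficients, so continuity, termwise differentiation and Cauchy
  products come from the scalar theory.\<close>

definition mexp_coeff :: "real^'n^'n \<Rightarrow> 'n \<Rightarrow> 'n \<Rightarrow> nat \<Rightarrow> real" where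
  "mexp_coeff B i j k = mpow B k $ i $ j / fact k"

lemma mexp_component: "mexp (t *\<^sub>R B) $ i $ j = (\<Sum>k. mexp_coeff B i j k * t ^ k)"
  by (simp add: mexp_def mexp_coeff_def mpow_scaleR mult.commute)

lemma summable_norm_mexp_coeff: "summable (\<lambda>k. norm (mexp_coeff B i j k * t ^ k))"
proof (rule summable_comparison_test')
  let ?c = "\<Sum>i\<in>UNIV. \<Sum>j\<in>UNIV. \<bar>B $ i $ j\<bar>"
  show "summable (\<lambda>k. inverse (fact k) * (?c * \<bar>t\<bar>) ^ k)"
    by (rule summable_exp)
  show "norm (norm (mexp_coeff B i j k * t ^ k)) \<le> inverse (fact k) * (?c * \<bar>t\<bar>) ^ k" for k
    using mult_right_mono[OF mpow_component_le[of B k i j], of "\<bar>t\<bar> ^ k"]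
    by (simp add: mexp_coeff_def abs_mult power_abs power_mult_distrib field_simps)
qed

lemma summable_mexp_coeff: "summable (\<lambda>k. mexp_coeff B i j k * t ^ k)"
  by (rule summable_norm_cancel[OF summable_norm_mexp_coeff])

lemma mexp_zero: "mexp (0 *\<^sub>R B) = mat 1"
proof -
  have "mexp (0 *\<^sub>R B) $ i $ j = mat 1 $ i $ j" for i j
    unfolding mexp_component powser_zero by (simp add: mexp_coeff_def)
  then show ?thesis by (simp add: vec_eq_iff)
qed

text \<open>Entrywise Cauchy product: summing over the inner index \<open>l\<close> joins two powers
  of \<open>B\<close> into the \<open>k\<close>-th power, and the remaining factors form the
  binomial expansion of \<open>(s + t) ^ k\<close>.\<close>

lemma mexp_add: "mexp ((s + t) *\<^sub>R B) = mexp (s *\<^sub>R B) ** mexp (t *\<^sub>R B)"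
proof -
  have "mexp ((s + t) *\<^sub>R B) $ i $ j = (mexp (s *\<^sub>R B) ** mexp (t *\<^sub>R B)) $ i $ j" for i j
  proof -
    let ?P = "\<lambda>l k. \<Sum>a\<le>k. (mexp_coeff B i l a * s ^ a) * (mexp_coeff B l j (k - a) * t ^ (k - a))"
    have "(\<Sum>l\<in>UNIV. ?P l k) = mexp_coeff B i j k * (s + t) ^ k" for k
    proof -
      have "(\<Sum>l\<in>UNIV. ?P l k) = (\<Sum>a\<le>k. (\<Sum>l\<in>UNIV. mpow B a $ i $ l * mpow B (k - a) $ l $ j) * (s ^ a * t ^ (k - a)) / (fact a * fact (k - a)))"
        by (subst sum.swap) (simp add: mexp_coeff_def sum_distrib_left sum_distrib_right sum_divide_distrib ac_simps)
      also have "\<dots> = (\<Sum>a\<le>k. mexp_coeff B i j k * (real (k choose a) * s ^ a * t ^ (k - a)))"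
      proof (intro sum.cong refl)
        fix a assume a: "a \<in> {..k}"
        have "(\<Sum>l\<in>UNIV. mpow B a $ i $ l * mpow B (k - a) $ l $ j) = mpow B k $ i $ j"
          using a mpow_add[of B a "k - a"] by (simp add: matrix_matrix_mult_def)
        then show "(\<Sum>l\<in>UNIV. mpow B a $ i $ l * mpow B (k - a) $ l $ j) * (s ^ a * t ^ (k - a)) / (fact a * fact (k - a))
          = mexp_coeff B i j k * (real (k choose a) * s ^ a * t ^ (k - a))"
          using a by (simp add: mexp_coeff_def binomial_fact)
      qed
      also have "\<dots> = mexp_coeff B i j k * (s + t) ^ k"
        by (simp add: binomial_ring sum_distrib_left)
      finally show ?thesis .
    qed
    moreover have "(\<lambda>k. \<Sum>l\<in>UNIV. ?P l k) sums (\<Sum>l\<in>UNIV. mexp (s *\<^sub>R B) $ i $ l * mexp (t *\<^sub>R B) $ l $ j)"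
      unfolding mexp_component
      by (intro sums_sum Cauchy_product_sums summable_norm_mexp_coeff)
    ultimately show ?thesis
      by (simp add: mexp_component sums_iff matrix_matrix_mult_def)
  qed
  then show ?thesis by (simp add: vec_eq_iff)
qed

lemma mexp_mult_minus: "mexp (t *\<^sub>R B) ** mexp ((- t) *\<^sub>R B) = mat 1"
  using mexp_add[of t "- t" B] mexp_zero[of B] by simp

lemma mexp_component_has_derivative:
  "((\<lambda>t. mexp (t *\<^sub>R B) $ i $ j) has_field_derivative (\<Sum>k. diffs (mexp_coeff B i j) k * t ^ k)) (at t)"
  unfolding mexp_component
  by (rule termdiffs_strong_converges_everywhere) (rule summable_mexp_coeff)

lemma mexp_component_has_derivative_0:
  "((\<lambda>t. mexp (t *\<^sub>R B) $ i $ j) has_field_derivative B $ i $ j) (at 0)"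
  using mexp_component_has_derivative[of B i j 0]
  by (simp only: powser_zero) (simp add: diffs_def mexp_coeff_def)

lemma continuous_mexp_component:
  "continuous_on S (\<lambda>t. mexp (t *\<^sub>R B) $ i $ j)"
  by (intro continuous_at_imp_continuous_on ballI DERIV_isCont[OF mexp_component_has_derivative])

text \<open>The Leibniz formula is differentiated term by term. A permutation other than the
  identity moves at least two points, so after one factor has been differentiated an off-diagonal
  entry of the identity matrix remains and kills the term.\<close>

lemma det_mexp_has_derivative_0:
  fixes B :: "real^'n^'n"
  shows "((\<lambda>t. det (mexp (t *\<^sub>R B))) has_field_derivative trace B) (at 0)"
proof -
  let ?d = "\<lambda>p. \<Sum>i\<in>UNIV. B $ i $ p i * (\<Prod>j\<in>UNIV - {i}. mexp (0 *\<^sub>R B) $ j $ p j)"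
  have d: "?d p = (if p = id then trace B else 0)" if "p permutes (UNIV::'n set)" for p
  proof (cases "p = id")
    case True
    then show ?thesis by (simp add: mexp_zero[of B, simplified] mat_def trace_def)
  next
    case False
    have "(\<Prod>j\<in>UNIV - {i}. mexp (0 *\<^sub>R B) $ j $ p j) = 0" for i
    proof -
      obtain k where k: "p k \<noteq> k" using False by (auto simp: fun_eq_iff)
      have "p (p k) \<noteq> p k" using k permutes_inj[OF that] by (auto dest: injD)
      then obtain j where "j \<noteq> i" "p j \<noteq> j" using k by metis
      then have "\<exists>j\<in>UNIV - {i}. mexp (0 *\<^sub>R B) $ j $ p j = 0"
        unfolding mexp_zero by (intro bexI[of _ j]) (auto simp: mat_def)
      then show ?thesis by (intro prod_zero) auto
    qed
    then have "?d p = (\<Sum>i\<in>(UNIV::'n set). 0)"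
      by (intro sum.cong refl) (simp only: mult_zero_right)
    then show ?thesis by (simp only: sum.neutral_const False if_False)
  qed
  have "((\<lambda>t. \<Sum>p | p permutes (UNIV::'n set). of_int (sign p) * (\<Prod>i\<in>UNIV. mexp (t *\<^sub>R B) $ i $ p i))
      has_derivative (\<lambda>y. \<Sum>p | p permutes (UNIV::'n set). of_int (sign p) *
         (\<Sum>i\<in>UNIV. (B $ i $ p i * y) * (\<Prod>j\<in>UNIV - {i}. mexp (0 *\<^sub>R B) $ j $ p j)))) (at 0)"
    using mexp_component_has_derivative_0[unfolded has_field_derivative_def]
    by (intro has_derivative_sum has_derivative_mult_right has_derivative_prod) auto
  moreover have "(\<Sum>i\<in>UNIV. (B $ i $ p i * y) * (\<Prod>j\<in>UNIV - {i}. mexp (0 *\<^sub>R B) $ j $ p j)) = ?d p * y" for p y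
    unfolding sum_distrib_right by (intro sum.cong refl) (simp only: ac_simps)
  moreover have "(\<Sum>p | p permutes (UNIV::'n set). of_int (sign p) * (?d p * y)) = trace B * y" for y
  proof -
    have "(\<Sum>p | p permutes (UNIV::'n set). of_int (sign p) * (?d p * y)) =
      (\<Sum>p | p permutes (UNIV::'n set). if p = id then trace B * y else 0)"
      by (intro sum.cong) (auto simp: d sign_id simp del: scale_zero_left)
    then show ?thesis by (simp add: permutes_id finite_permutations)
  qed
  ultimately show ?thesis unfolding det_def has_field_derivative_def by simp
qed

lemma det_mexp_pos: "det (mexp (t *\<^sub>R B)) > 0"
proof -
  have "det (mexp (t *\<^sub>R B)) = det (mexp ((t / 2) *\<^sub>R B)) ^ 2"
    using mexp_add[of "t / 2" "t / 2" B] by (simp add: det_mul power2_eq_square)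
  moreover have "det (mexp ((t / 2) *\<^sub>R B)) \<noteq> 0"
    using arg_cong[OF mexp_mult_minus[of "t / 2" B], of det] by (auto simp: det_mul)
  ultimately show ?thesis by simp
qed

text \<open>The group law carries the derivative at 0 to every point, giving Liouville's equation:
  the derivative is the determinant times \<open>trace B\<close>. A nonnegative trace thus makes the
  flow volume-expanding.\<close>

lemma det_mexp_ge_1:
  assumes "trace B \<ge> 0" "t \<ge> 0"
  shows "det (mexp (t *\<^sub>R B)) \<ge> 1"
proof -
  have "((\<lambda>r. det (mexp (r *\<^sub>R B))) has_field_derivative det (mexp (x *\<^sub>R B)) * trace B) (at x)" for x
  proof -
    have "((\<lambda>h. det (mexp (x *\<^sub>R B)) * det (mexp (h *\<^sub>R B))) has_field_derivative det (mexp (x *\<^sub>R B)) * trace B) (at (x + - x))"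
      using DERIV_cmult[OF det_mexp_has_derivative_0] by simp
    then have "((\<lambda>r. det (mexp (x *\<^sub>R B)) * det (mexp ((r - x) *\<^sub>R B))) has_field_derivative det (mexp (x *\<^sub>R B)) * trace B) (at x)"
      by (subst (asm) DERIV_shift) simp
    moreover have "det (mexp (x *\<^sub>R B)) * det (mexp ((r - x) *\<^sub>R B)) = det (mexp (r *\<^sub>R B))" for r
      using mexp_add[of x "r - x" B] by (simp add: det_mul)
    ultimately show ?thesis by simp
  qed
  moreover have "0 \<le> det (mexp (x *\<^sub>R B)) * trace B" for x
    using assms less_imp_le[OF det_mexp_pos] by (intro mult_nonneg_nonneg) auto
  ultimately have "det (mexp (0 *\<^sub>R B)) \<le> det (mexp (t *\<^sub>R B))"
    by (intro DERIV_nonneg_imp_nondecreasing[OF assms(2)] exI conjI)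
  then show ?thesis unfolding mexp_zero by simp
qed

text \<open>Negative times are included because the modulus estimate also runs the flow
  backwards.\<close>

lemma mexp_bounded:
  obtains c where "c > 0" "\<And>r x. r \<in> {-1..1} \<Longrightarrow> norm (mexp (r *\<^sub>R B) *v x) \<le> c * norm x"
proof -
  have "\<exists>b. \<forall>r\<in>{-1..1}. \<bar>mexp (r *\<^sub>R B) $ i $ j\<bar> \<le> b" for i j
    using compact_imp_bounded[OF compact_continuous_image[OF continuous_mexp_component[of "{-1..1}" B i j] compact_Icc]]
    by (auto simp: bounded_iff)
  then obtain b where b: "\<And>i j r. r \<in> {-1..1} \<Longrightarrow> \<bar>mexp (r *\<^sub>R B) $ i $ j\<bar> \<le> b i j" by metis
  let ?b = "1 + (\<Sum>i\<in>UNIV. \<Sum>j\<in>UNIV. \<bar>b i j\<bar>)"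
  show ?thesis
  proof (rule that[of ?b])
    show "?b > 0" by (intro add_pos_nonneg sum_nonneg) auto
    fix r :: real and x assume r: "r \<in> {-1..1}"
    have "onorm ((*v) (mexp (r *\<^sub>R B))) \<le> (\<Sum>i\<in>UNIV. \<Sum>j\<in>UNIV. \<bar>mexp (r *\<^sub>R B) $ i $ j\<bar>)"
      by (rule onorm_le_matrix_component_sum)
    also have "\<dots> \<le> (\<Sum>i\<in>UNIV. \<Sum>j\<in>UNIV. \<bar>b i j\<bar>)"
      using b[OF r] by (intro sum_mono) (meson abs_ge_self order_trans)
    finally have "onorm ((*v) (mexp (r *\<^sub>R B))) \<le> ?b" by simp
    then show "norm (mexp (r *\<^sub>R B) *v x) \<le> ?b * norm x"
      using onorm[OF matrix_vector_mul_bounded_linear[of "mexp (r *\<^sub>R B)"], of x]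
      by (meson mult_right_mono norm_ge_zero order_trans)
  qed
qed

lemma mexp_diff_bounded:
  obtains c where "c > 0" "\<And>u x. u \<in> {0..1} \<Longrightarrow> norm (mexp (u *\<^sub>R B) *v x - x) \<le> c * u * norm x"
proof -
  have "\<exists>b. \<forall>u\<in>{0..1}. \<bar>(mexp (u *\<^sub>R B) - mat 1) $ i $ j\<bar> \<le> b * u" for i j
  proof -
    \<comment> \<open>The power series of the entry with its constant term removed, divided by
      \<open>u\<close>; being continuous, it is bounded on [0,1].\<close>
    let ?D = "\<lambda>u. \<Sum>k. mexp_coeff B i j (Suc k) * u ^ k"
    have sm: "summable (\<lambda>k. mexp_coeff B i j (Suc k) * u ^ k)" for u
      using powser_split_head(3)[OF summable_mexp_coeff] .
    have "(?D has_field_derivative (\<Sum>k. diffs (\<lambda>k. mexp_coeff B i j (Suc k)) k * u ^ k)) (at u)" for u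
      by (rule termdiffs_strong_converges_everywhere) (rule sm)
    then have "continuous_on {0..1} ?D"
      by (intro continuous_at_imp_continuous_on ballI DERIV_isCont)
    from compact_imp_bounded[OF compact_continuous_image[OF this compact_Icc]]
    obtain b where b: "\<forall>u\<in>{0..1}. \<bar>?D u\<bar> \<le> b" by (auto simp: bounded_iff)
    have "(mexp (u *\<^sub>R B) - mat 1) $ i $ j = ?D u * u" for u
      using powser_split_head(1)[OF summable_mexp_coeff, of B i j u]
      by (simp add: mexp_component) (simp add: mexp_coeff_def)
    with b show ?thesis by (intro exI[of _ b]) (auto simp: abs_mult intro!: mult_right_mono)
  qed
  then obtain b where b: "\<And>i j u. u \<in> {0..1} \<Longrightarrow> \<bar>(mexp (u *\<^sub>R B) - mat 1) $ i $ j\<bar> \<le> b i j * u" by metis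
  let ?b = "1 + (\<Sum>i\<in>UNIV. \<Sum>j\<in>UNIV. \<bar>b i j\<bar>)"
  show ?thesis
  proof (rule that[of ?b])
    show "?b > 0" by (intro add_pos_nonneg sum_nonneg) auto
    fix u :: real and x assume u: "u \<in> {0..1}"
    let ?M = "mexp (u *\<^sub>R B) - mat 1"
    have "onorm ((*v) ?M) \<le> (\<Sum>i\<in>UNIV. \<Sum>j\<in>UNIV. \<bar>?M $ i $ j\<bar>)"
      by (rule onorm_le_matrix_component_sum)
    also have "\<dots> \<le> (\<Sum>i\<in>UNIV. \<Sum>j\<in>UNIV. \<bar>b i j\<bar> * u)"
      using b[OF u] u by (intro sum_mono) (meson abs_ge_self order_trans mult_right_mono atLeastAtMost_iff)
    also have "\<dots> \<le> ?b * u" using u by (simp add: sum_distrib_right distrib_right)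
    finally have "onorm ((*v) ?M) \<le> ?b * u" .
    then have "norm (?M *v x) \<le> ?b * u * norm x"
      using onorm[OF matrix_vector_mul_bounded_linear[of ?M], of x]
      by (meson mult_right_mono norm_ge_zero order_trans)
    then show "norm (mexp (u *\<^sub>R B) *v x - x) \<le> ?b * u * norm x"
      by (simp add: matrix_vector_mult_diff_rdistrib)
  qed
qed

section \<open>The heat kernel\<close>

definition cov_density :: "real^'n^'n \<Rightarrow> real^'n^'n \<Rightarrow> real \<Rightarrow> real^'n^'n" where
  "cov_density Q B r = mexp (r *\<^sub>R B) ** Q ** transpose (mexp (r *\<^sub>R B))"

lemma continuous_on_matrixI:
  fixes F :: "'a::topological_space \<Rightarrow> real^'n^'m"
  assumes "\<And>i j. continuous_on S (\<lambda>x. F x $ i $ j)"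
  shows "continuous_on S F"
proof -
  have "continuous_on S (\<lambda>x. \<chi> i j. F x $ i $ j)"
    by (intro continuous_on_vec_lambda assms)
  then show ?thesis by simp
qed

lemma continuous_on_cov_density: "continuous_on S (cov_density Q B)"
  by (rule continuous_on_matrixI)
    (auto simp: cov_density_def matrix_matrix_mult_def transpose_def
      intro!: continuous_intros continuous_mexp_component)

lemma cov_density_integrable: "cov_density Q B integrable_on {a..b}"
  by (intro integrable_continuous_real continuous_on_cov_density)

text \<open>For positive \<open>t\<close> this is tK(t): without the averaging factor the family is
  additive along the flow. Integrating the matrix as a whole lets transposition, conjugation and
  entries, all bounded linear, pass through the integral.\<close>

definition cov :: "real^'n^'n \<Rightarrow> real^'n^'n \<Rightarrow> real \<Rightarrow> real^'n^'n" where
  "cov Q B t = integral {0..t} (cov_density Q B)"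

lemma bounded_linear_component: "bounded_linear (\<lambda>M::real^'n^'m. M $ i $ j)"
  by (intro linear_conv_bounded_linear[THEN iffD1] linearI) auto

lemma scaleR_Kmat:
  assumes "t > 0"
  shows "t *\<^sub>R Kmat Q B t = cov Q B t"
proof -
  have "(t *\<^sub>R Kmat Q B t) $ i $ j = cov Q B t $ i $ j" for i j
  proof -
    have "(t *\<^sub>R Kmat Q B t) $ i $ j = (LBINT r=ereal 0..ereal t. cov_density Q B r $ i $ j)"
      using assms by (simp add: Kmat_def cov_density_def zero_ereal_def)
    also have "\<dots> = integral {0..t} (\<lambda>r. cov_density Q B r $ i $ j)"
    proof (rule interval_integral_eq_integral)
      show "set_integrable lborel {0..t} (\<lambda>r. cov_density Q B r $ i $ j)"
        by (intro borel_integrable_atLeastAtMost' continuous_intros continuous_on_cov_density)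
    qed (use assms in simp)
    also have "\<dots> = cov Q B t $ i $ j"
      using integral_linear[OF cov_density_integrable[of Q B 0 t] bounded_linear_component[of i j]]
      by (simp add: cov_def o_def)
    finally show ?thesis .
  qed
  then show ?thesis by (simp add: vec_eq_iff)
qed

lemma transpose_cov:
  assumes "transpose Q = Q"
  shows "transpose (cov Q B t) = cov Q B t"
proof -
  have "linear (transpose :: real^'n^'n \<Rightarrow> real^'n^'n)"
    by (intro linearI) (auto simp: transpose_scaleR_matrix transpose_add_matrix)
  then have "bounded_linear (transpose :: real^'n^'n \<Rightarrow> real^'n^'n)"
    by (simp add: linear_conv_bounded_linear)
  from integral_linear[OF cov_density_integrable[of Q B 0 t] this]
  have "transpose (cov Q B t) = integral {0..t} (transpose \<circ> cov_density Q B)"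
    by (simp only: cov_def)
  also have "transpose \<circ> cov_density Q B = cov_density Q B"
    by (simp add: fun_eq_iff cov_density_def matrix_transpose_mul matrix_mul_assoc assms)
  finally show ?thesis by (simp only: cov_def)
qed

lemma cov_density_add:
  "cov_density Q B (\<tau> + r) = mexp (\<tau> *\<^sub>R B) ** cov_density Q B r ** transpose (mexp (\<tau> *\<^sub>R B))"
  by (simp add: cov_density_def mexp_add matrix_transpose_mul matrix_mul_assoc)

text \<open>The integral is cut at \<tau>; on the later piece the density is the density on [0,t]
  conjugated by the flow at time \<tau>. This is the algebra behind Chapman-Kolmogorov.\<close>

lemma cov_add:
  assumes "t \<ge> 0" "\<tau> \<ge> 0"
  shows "cov Q B (t + \<tau>) = cov Q B \<tau> + mexp (\<tau> *\<^sub>R B) ** cov Q B t ** transpose (mexp (\<tau> *\<^sub>R B))"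
proof -
  let ?E = "mexp (\<tau> *\<^sub>R B)"
  have "linear (\<lambda>M. ?E ** M ** transpose ?E)"
    by (intro linearI)
      (auto simp: vec_eq_iff matrix_matrix_mult_def sum.distrib sum_distrib_left sum_distrib_right algebra_simps)
  then have "bounded_linear (\<lambda>M. ?E ** M ** transpose ?E)"
    by (simp add: linear_conv_bounded_linear)
  from integral_linear[OF cov_density_integrable[of Q B 0 t] this]
  have "?E ** cov Q B t ** transpose ?E = integral {0..t} (cov_density Q B \<circ> (\<lambda>r. r + \<tau>))"
    by (simp add: cov_def o_def cov_density_add[symmetric] add.commute)
  also have "\<dots> = integral {0 + \<tau>..t + \<tau>} (cov_density Q B)"
    by (rule integral_shift[OF continuous_on_cov_density])
  finally show ?thesis
    using Henstock_Kurzweil_Integration.integral_combine[where a=0 and c=\<tau> and b="t + \<tau>" and f="cov_density Q B", OF _ _ cov_density_integrable] assms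
    by (simp add: cov_def)
qed

lemma continuous_on_cov: "continuous_on {0<..} (cov Q B)"
proof (intro continuous_at_imp_continuous_on ballI)
  fix t :: real assume t: "t \<in> {0<..}"
  have "continuous_on {0..t + 1} (cov Q B)"
    unfolding cov_def by (intro indefinite_integral_continuous_1 cov_density_integrable)
  then show "isCont (cov Q B) t"
    using t by (intro continuous_on_interior[of "{0..t + 1}"]) (auto simp: interior_atLeastAtMost_real)
qed

lemma trace_cov_le:
  obtains c where "c > 0" "\<And>u. u \<in> {0..1} \<Longrightarrow> trace (cov Q B u) \<le> c * u"
proof -
  obtain b where b: "\<forall>r\<in>{0..1}. norm (cov_density Q B r) \<le> b"
    using compact_imp_bounded[OF compact_continuous_image[OF continuous_on_cov_density[of "{0..1}" Q B] compact_Icc]]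
    by (auto simp: bounded_iff)
  let ?c = "1 + real CARD('a) * \<bar>b\<bar>"
  show ?thesis
  proof (rule that[of ?c])
    fix u :: real assume u: "u \<in> {0..1}"
    have n: "norm (cov Q B u) \<le> b * (u - 0)"
      unfolding cov_def using u b by (intro integral_bound continuous_on_cov_density) auto
    have "trace (cov Q B u) \<le> (\<Sum>i\<in>(UNIV::'a set). norm (cov Q B u))"
      unfolding trace_def
    proof (intro sum_mono)
      fix i :: 'a
      have "cov Q B u $ i $ i \<le> \<bar>cov Q B u $ i $ i\<bar>" by simp
      also have "\<dots> \<le> norm (cov Q B u $ i)" by (rule component_le_norm_cart)
      also have "\<dots> \<le> norm (cov Q B u)" by (rule Finite_Cartesian_Product.norm_nth_le)
      finally show "cov Q B u $ i $ i \<le> norm (cov Q B u)" .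
    qed
    also have "\<dots> \<le> real CARD('a) * (\<bar>b\<bar> * u)"
      using n u by simp (meson abs_ge_self mult_right_mono order_trans)
    also have "\<dots> \<le> ?c * u" using u by (simp add: distrib_right)
    finally show "trace (cov Q B u) \<le> ?c * u" .
  qed (simp add: add_pos_nonneg)
qed

lemma borel_measurable_det:
  fixes A :: "'a \<Rightarrow> real^'n^'n"
  assumes [measurable]: "\<And>i j. (\<lambda>x. A x $ i $ j) \<in> borel_measurable M"
  shows "(\<lambda>x. det (A x)) \<in> borel_measurable M"
  unfolding det_def by measurable

text \<open>Cramer's rule expresses the inverse matrix applied to \<open>w x\<close> by quotients of
  determinants, which are polynomials in the entries; no measurability of \<open>matrix_inv\<close>
  itself enters.\<close>

lemma borel_measurable_gauss_family:
  fixes A :: "'a \<Rightarrow> real^'n^'n" and w :: "'a \<Rightarrow> real^'n"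
  assumes A[measurable]: "\<And>i j. (\<lambda>x. A x $ i $ j) \<in> borel_measurable M"
    and w[measurable]: "\<And>i. (\<lambda>x. w x $ i) \<in> borel_measurable M"
    and d: "\<And>x. det (A x) \<noteq> 0"
  shows "(\<lambda>x. gauss (A x) (w x)) \<in> borel_measurable M"
proof -
  have [measurable]: "(\<lambda>x. det (A x)) \<in> borel_measurable M"
    by (rule borel_measurable_det) measurable
  have [measurable]: "(\<lambda>x. det (\<chi> i j. if j = k then w x $ i else A x $ i $ j)) \<in> borel_measurable M" for k
  proof (rule borel_measurable_det)
    show "(\<lambda>x. (\<chi> i j. if j = k then w x $ i else A x $ i $ j) $ i $ j) \<in> borel_measurable M" for i j
      by (cases "j = k") auto
  qed
  have "matrix_inv (A x) *v w x = (\<chi> k. det (\<chi> i j. if j = k then w x $ i else A x $ i $ j) / det (A x))" for x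
    using cramer[OF d[of x], of "matrix_inv (A x) *v w x" "w x"]
    by (simp add: matrix_vector_mul_assoc matrix_inv_right d)
  then have "(\<lambda>x. gauss (A x) (w x)) = (\<lambda>x. (4 * pi) powr (- real CARD('n) / 2) * det (A x) powr (-1/2) *
     exp (- (\<Sum>k\<in>UNIV. w x $ k * (det (\<chi> i j. if j = k then w x $ i else A x $ i $ j) / det (A x))) / 4))"
    by (simp add: gauss_def inner_vec_def)
  also have "\<dots> \<in> borel_measurable M" by measurable
  finally show ?thesis .
qed

lemma nn_integral_lborel_minus:
  fixes f :: "'a::euclidean_space \<Rightarrow> ennreal"
  assumes [measurable]: "f \<in> borel_measurable borel"
  shows "(\<integral>\<^sup>+x. f (c - x) \<partial>lborel) = (\<integral>\<^sup>+x. f x \<partial>lborel)"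
  by (subst (2) lborel_affine[of "- 1" c]) (simp_all add: nn_integral_density nn_integral_distr)

lemma borel_measurable_vec_nth[measurable (raw)]:
  fixes f :: "'a \<Rightarrow> real^'n"
  assumes [measurable]: "f \<in> borel_measurable M"
  shows "(\<lambda>x. f x $ i) \<in> borel_measurable M"
proof -
  have "(\<lambda>x. f x \<bullet> axis i 1) \<in> borel_measurable M" by measurable
  then show ?thesis by (simp add: inner_axis)
qed

section \<open>The heat kernel as a Gaussian transported by the flow\<close>

locale kolmogorov =
  fixes Q B :: "real^'n^'n"
  assumes Q_sym: "transpose Q = Q"
    and K_pos: "\<And>t. t > 0 \<Longrightarrow> pos_def_mat (Kmat Q B t)"
    and B_trace: "trace B \<ge> 0"
begin

abbreviation "C \<equiv> cov Q B"

definition flow :: "real \<Rightarrow> real^'n^'n" where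
  "flow t = mexp (t *\<^sub>R B)"

lemma flow_add: "flow (s + t) = flow s ** flow t"
  unfolding flow_def by (rule mexp_add)

lemma flow_minus: "flow (- t) ** flow t = mat 1" "flow t ** flow (- t) = mat 1"
  using mexp_mult_minus[of "- t" B] mexp_mult_minus[of t B] by (simp_all add: flow_def)

lemma cov_add_flow:
  "t \<ge> 0 \<Longrightarrow> \<tau> \<ge> 0 \<Longrightarrow> C (t + \<tau>) = C \<tau> + flow \<tau> ** C t ** transpose (flow \<tau>)"
  unfolding flow_def by (rule cov_add)

lemma cov_pos_def: "t > 0 \<Longrightarrow> pos_def_mat (C t)"
  using K_pos[of t] scaleR_Kmat[of t Q B]
  unfolding pos_def_mat_def by (metis inner_scaleR_right mult_pos_pos scaleR_matrix_vector_assoc)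

lemmas cov_sym = transpose_cov[OF Q_sym, of B]

lemma det_cov_pos: "t > 0 \<Longrightarrow> det (C t) > 0"
  using pos_def_mat_det_pos[OF cov_sym cov_pos_def] .

lemma flow_inverse: "flow (- t) *v (flow t *v x) = x" "flow t *v (flow (- t) *v x) = x"
  by (simp_all add: matrix_vector_mul_assoc flow_minus)

lemma det_flow: "det (flow t) > 0"
  by (simp add: flow_def det_mexp_pos)

lemma heat_kernel_eq_gauss:
  assumes "t > 0"
  shows "heat_kernel Q B X Y t = gauss (C t) (Y - flow t *v X)"
proof -
  have dK: "det (Kmat Q B t) \<noteq> 0"
  proof -
    have "Kmat Q B t = (1 / t) *\<^sub>R C t" using assms by (simp flip: scaleR_Kmat)
    then have "transpose (Kmat Q B t) = Kmat Q B t" by (simp add: transpose_scaleR_matrix cov_sym)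
    from pos_def_mat_det_pos[OF this K_pos[OF assms]] show ?thesis by simp
  qed
  have "matrix_inv (C t) = (1 / t) *\<^sub>R matrix_inv (Kmat Q B t)"
  proof (rule matrix_inv_eqI)
    have "(t *\<^sub>R A) ** ((1 / t) *\<^sub>R A') = A ** A'" for A A' :: "real^'n^'n"
      using assms by (simp add: vec_eq_iff matrix_matrix_mult_def)
    then show "C t ** ((1 / t) *\<^sub>R matrix_inv (Kmat Q B t)) = mat 1"
      using dK by (simp add: scaleR_Kmat[OF assms, symmetric] matrix_inv_right)
  qed
  then have "w \<bullet> (matrix_inv (C t) *v w) = w \<bullet> (matrix_inv (Kmat Q B t) *v w) / t" for w
    by (simp add: scaleR_matrix_vector_assoc[symmetric])
  then show ?thesis
    by (simp add: heat_kernel_def gauss_def msq_def flow_def scaleR_Kmat[OF assms])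
qed

text \<open>Pulling back by the reversed flow shows the kernel as a reflected, translated Gaussian
  in its first variable, ready for integration over \<open>X\<close>.\<close>

lemma heat_kernel_eq_gauss_inverse:
  assumes "t > 0"
  shows "heat_kernel Q B X Y t =
    det (flow (- t)) * gauss (flow (- t) ** C t ** transpose (flow (- t))) (flow (- t) *v Y - X)"
proof -
  have "flow (- t) *v Y - X = flow (- t) *v (Y - flow t *v X)"
    by (simp add: matrix_vector_mult_diff_distrib flow_inverse)
  then show ?thesis
    using gauss_congruent[OF det_cov_pos[OF assms], of "flow (- t)" "Y - flow t *v X"] det_flow[of "- t"]
    by (simp only: heat_kernel_eq_gauss[OF assms] abs_of_pos)
qed

lemma heat_kernel_nonneg: "t > 0 \<Longrightarrow> 0 \<le> heat_kernel Q B X Y t"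
  by (simp add: heat_kernel_eq_gauss gauss_nonneg)

lemma borel_measurable_heat_kernel:
  "(\<lambda>(t, X, Y). if 0 < t then heat_kernel Q B X Y t else 0) \<in> borel_measurable (borel \<Otimes>\<^sub>M borel \<Otimes>\<^sub>M borel)"
proof -
  \<comment> \<open>The identity matrix is a default for nonpositive times: the measurability lemma
    asks for a nonzero determinant everywhere, and the \<open>if\<close> later discards these
    values.\<close>
  define A where "A t = (if t \<in> {0<..} then C t else mat 1)" for t
  have dA: "det (A t) \<noteq> 0" for t using det_cov_pos[of t] by (auto simp: A_def)
  have A: "(\<lambda>t. A t $ i $ j) \<in> borel_measurable borel" for i j
    unfolding A_def if_distrib[where f="\<lambda>M. M $ i $ j"]
    by (intro borel_measurable_continuous_on_if continuous_intros continuous_on_cov) auto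
  have E[measurable]: "(\<lambda>t. flow t $ i $ j) \<in> borel_measurable borel" for i j
    unfolding flow_def by (intro borel_measurable_continuous_onI continuous_mexp_component)
  have "(\<lambda>z. gauss (A (fst z)) (snd (snd z) - flow (fst z) *v fst (snd z))) \<in> borel_measurable (borel \<Otimes>\<^sub>M borel \<Otimes>\<^sub>M borel)"
  proof (rule borel_measurable_gauss_family)
    show "(\<lambda>z. A (fst z) $ i $ j) \<in> borel_measurable (borel \<Otimes>\<^sub>M borel \<Otimes>\<^sub>M borel)" for i j
      using A[of i j] by measurable
    show "(\<lambda>z. (snd (snd z) - flow (fst z) *v fst (snd z)) $ i) \<in> borel_measurable (borel \<Otimes>\<^sub>M borel \<Otimes>\<^sub>M borel)" for i
      unfolding matrix_vector_mult_def vector_minus_component vec_lambda_beta by measurable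
  qed (rule dA)
  then have "(\<lambda>z. if 0 < fst z then gauss (A (fst z)) (snd (snd z) - flow (fst z) *v fst (snd z)) else 0)
      \<in> borel_measurable (borel \<Otimes>\<^sub>M borel \<Otimes>\<^sub>M borel)"
    by measurable
  then show ?thesis
    by (rule measurable_cong[THEN iffD1, rotated]) (auto simp: heat_kernel_eq_gauss A_def)
qed

lemma nn_integral_heat_kernel_right:
  assumes "t > 0"
  shows "(\<integral>\<^sup>+Y. ennreal (heat_kernel Q B X Y t) \<partial>lborel) = 1"
proof -
  have "(\<integral>\<^sup>+Y. ennreal (heat_kernel Q B X Y t) \<partial>lborel) = (\<integral>\<^sup>+Y. ennreal (gauss (C t) (- (flow t *v X) + Y)) \<partial>lborel)"
    by (simp add: heat_kernel_eq_gauss[OF assms])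
  also have "\<dots> = (\<integral>\<^sup>+Y. ennreal (gauss (C t) Y) \<partial>lborel)"
    by (rule nn_integral_lborel_plus) measurable
  also have "\<dots> = 1" by (rule nn_integral_gauss[OF cov_sym cov_pos_def[OF assms]])
  finally show ?thesis .
qed

lemma conjugate_cov:
  assumes "t > 0"
  shows "transpose (flow r ** C t ** transpose (flow r)) = flow r ** C t ** transpose (flow r)"
    and "pos_def_mat (flow r ** C t ** transpose (flow r))"
proof -
  show "transpose (flow r ** C t ** transpose (flow r)) = flow r ** C t ** transpose (flow r)"
    by (simp add: matrix_transpose_mul matrix_mul_assoc cov_sym)
  have "det (flow r) \<noteq> 0" using det_flow[of r] by simp
  then show "pos_def_mat (flow r ** C t ** transpose (flow r))"
    by (rule pos_def_mat_congruent[OF cov_pos_def[OF assms]])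
qed

text \<open>Integrating over the starting point leaves the Jacobian of the reversed flow, which is
  at most 1 since the forward flow expands volume. Dual evolutions therefore stay below 1.\<close>

lemma nn_integral_heat_kernel_left:
  assumes "t > 0"
  shows "(\<integral>\<^sup>+X. ennreal (heat_kernel Q B X Y t) \<partial>lborel) \<le> 1"
proof -
  let ?A = "flow (- t) ** C t ** transpose (flow (- t))"
  have d: "det (flow (- t)) \<le> 1"
  proof -
    have "1 \<le> det (flow t)" using det_mexp_ge_1[OF B_trace] assms by (simp add: flow_def)
    then have "det (flow (- t)) * 1 \<le> det (flow (- t)) * det (flow t)"
      using det_flow[of "- t"] by (intro mult_left_mono) auto
    then show ?thesis using flow_minus(1)[of t] det_mul[of "flow (- t)" "flow t"] by simp
  qed
  have "(\<integral>\<^sup>+X. ennreal (heat_kernel Q B X Y t) \<partial>lborel) =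
    ennreal (det (flow (- t))) * (\<integral>\<^sup>+X. ennreal (gauss ?A (flow (- t) *v Y - X)) \<partial>lborel)"
    using det_flow[of "- t"]
    by (simp add: heat_kernel_eq_gauss_inverse[OF assms] ennreal_mult gauss_nonneg nn_integral_cmult)
  also have "(\<integral>\<^sup>+X. ennreal (gauss ?A (flow (- t) *v Y - X)) \<partial>lborel) = 1"
    by (subst nn_integral_lborel_minus[of "\<lambda>x. ennreal (gauss ?A x)"])
      (auto intro: nn_integral_gauss conjugate_cov[OF assms])
  finally show ?thesis using d by (simp add: ennreal_le_1)
qed

text \<open>Translating \<open>Z\<close> by the flow image of \<open>X\<close> turns the integral
  into a convolution of two centred Gaussians. Their matrices add up to the conjugate of
  \<open>C (t + \<tau>)\<close> by the reversed flow, by the cocycle identity.\<close>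

lemma heat_kernel_chapman_kolmogorov:
  assumes t: "t > 0" and \<tau>: "\<tau> > 0"
  shows "(\<integral>\<^sup>+Z. ennreal (heat_kernel Q B X Z t) * ennreal (heat_kernel Q B Z Y \<tau>) \<partial>lborel) = ennreal (heat_kernel Q B X Y (t + \<tau>))"
proof -
  let ?R = "flow (- \<tau>)"
  let ?A = "?R ** C \<tau> ** transpose ?R"
  let ?d = "det ?R" and ?x = "flow t *v X"
  have d: "?d > 0" by (rule det_flow)
  have "(\<integral>\<^sup>+Z. ennreal (heat_kernel Q B X Z t) * ennreal (heat_kernel Q B Z Y \<tau>) \<partial>lborel)
      = (\<integral>\<^sup>+Z. ennreal (gauss (C t) (- ?x + Z)) * ennreal (?d * gauss ?A ((?R *v Y - ?x) - (- ?x + Z))) \<partial>lborel)"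
    by (simp add: heat_kernel_eq_gauss[OF t] heat_kernel_eq_gauss_inverse[OF \<tau>])
  also have "\<dots> = (\<integral>\<^sup>+z. ennreal (gauss (C t) z) * ennreal (?d * gauss ?A ((?R *v Y - ?x) - z)) \<partial>lborel)"
    by (rule nn_integral_lborel_plus) measurable
  also have "\<dots> = ennreal ?d * (\<integral>\<^sup>+z. ennreal (gauss (C t) z) * ennreal (gauss ?A ((?R *v Y - ?x) - z)) \<partial>lborel)"
    using d by (subst nn_integral_cmult[symmetric]) (auto simp: ennreal_mult gauss_nonneg ac_simps)
  also have "\<dots> = ennreal ?d * ennreal (gauss (C t + ?A) (?R *v Y - ?x))"
    by (subst gauss_convolution) (use cov_sym cov_pos_def[OF t] conjugate_cov[OF \<tau>] in auto)
  also have "C t + ?A = ?R ** C (t + \<tau>) ** transpose ?R"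
  proof -
    have "?R ** (flow \<tau> ** C t ** transpose (flow \<tau>)) ** transpose ?R = (?R ** flow \<tau>) ** C t ** transpose (?R ** flow \<tau>)"
      by (simp add: matrix_mul_assoc matrix_transpose_mul)
    also have "?R ** flow \<tau> = mat 1" by (rule flow_minus)
    finally show ?thesis
      using t \<tau> cov_add_flow[of t \<tau>] by (simp add: matrix_add_ldistrib matrix_add_rdistrib)
  qed
  also have "?R *v Y - ?x = ?R *v (Y - flow (t + \<tau>) *v X)"
    by (simp add: matrix_vector_mult_diff_distrib add.commute[of t] flow_add flow_inverse flip: matrix_vector_mul_assoc)
  also have "ennreal ?d * ennreal (gauss (?R ** C (t + \<tau>) ** transpose ?R) (?R *v (Y - flow (t + \<tau>) *v X)))
     = ennreal (heat_kernel Q B X Y (t + \<tau>))"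
    using d t \<tau> gauss_congruent[OF det_cov_pos[of "t + \<tau>"], of ?R "Y - flow (t + \<tau>) *v X"]
    by (simp add: ennreal_mult[symmetric] gauss_nonneg heat_kernel_eq_gauss)
  finally show ?thesis .
qed

lemma heat_kernel_le:
  assumes "t > 0"
  shows "heat_kernel Q B X Y t \<le> (4 * pi) powr (- real CARD('n) / 2) * det (C t) powr (-1/2)"
proof -
  let ?w = "Y - flow t *v X"
  have "0 \<le> ?w \<bullet> (matrix_inv (C t) *v ?w)"
    using pos_def_mat_inv[OF cov_sym cov_pos_def[OF assms]]
    by (cases "?w = 0") (auto simp: pos_def_mat_def intro: less_imp_le)
  then show ?thesis
    unfolding heat_kernel_eq_gauss[OF assms] gauss_def by (intro mult_left_le) auto
qed

end

section \<open>Schwartz functions\<close>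

text \<open>These weights measure Schwartz decay: they are comparable at points of distance at most
  1, and raising the exponent by one absorbs a factor \<open>norm x\<close>.\<close>

definition decay_weight :: "nat \<Rightarrow> real^'n \<Rightarrow> real" where
  "decay_weight m x = inverse ((1 + norm x) ^ m)"

lemma decay_weight_pos: "0 < decay_weight m x"
  by (simp add: decay_weight_def add_pos_nonneg)

lemma borel_measurable_decay_weight[measurable]: "decay_weight m \<in> borel_measurable borel"
  unfolding decay_weight_def by measurable

lemma decay_weight_Suc_le: "decay_weight (Suc m) x \<le> decay_weight m x"
proof -
  have "inverse (1 + norm x) \<le> inverse 1" by (intro le_imp_inverse_le) auto
  then show ?thesis
    using decay_weight_pos[of m x] mult_right_mono[of "inverse (1 + norm x)" 1 "decay_weight m x"]
    by (simp add: decay_weight_def)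
qed

lemma norm_decay_weight_Suc_le: "norm x * decay_weight (Suc m) x \<le> decay_weight m x"
proof -
  have p: "0 < (1 + norm x) ^ m" "0 < 1 + norm x" by (simp_all add: add_pos_nonneg)
  then have "norm x * decay_weight (Suc m) x = (norm x / (1 + norm x)) * decay_weight m x"
    by (simp add: decay_weight_def field_simps)
  also have "\<dots> \<le> 1 * decay_weight m x"
    using p decay_weight_pos[of m x] by (intro mult_right_mono) auto
  finally show ?thesis by simp
qed

lemma decay_weight_nearby:
  assumes "norm (z - x) \<le> 1"
  shows "decay_weight m z \<le> 2 ^ m * decay_weight m x"
proof -
  have "1 + norm x \<le> 2 * (1 + norm z)"
    using norm_triangle_ineq2[of x z] assms norm_ge_zero[of z] norm_minus_commute[of z x]
    by (smt (verit, best))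
  then have "(1 + norm x) ^ m \<le> 2 ^ m * (1 + norm z) ^ m"
    by (metis add_nonneg_nonneg norm_ge_zero power_mono power_mult_distrib zero_le_one)
  then show ?thesis
    by (simp add: decay_weight_def field_simps add_pos_nonneg)
qed

text \<open>The exponent is twice the dimension because each coordinate uses up one factor
  \<open>(1 + norm x)\<^sup>2\<close>, which dominates one plus the square of that coordinate; the
  integral then splits into one-dimensional ones.\<close>

lemma nn_integral_decay_weight_finite:
  "(\<integral>\<^sup>+x. ennreal (decay_weight (2 * CARD('n)) (x :: real^'n)) \<partial>lborel) < \<infinity>"
proof -
  have I: "(\<integral>\<^sup>+(x::real). ennreal (inverse (1 + x\<^sup>2)) \<partial>lborel) < \<infinity>"
    using integrable_inverse_1_plus_square
    by (simp add: set_integrable_def integrable_iff_bounded less_top)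
  have "decay_weight (2 * CARD('n)) x \<le> (\<Prod>b\<in>Basis. inverse (1 + (x \<bullet> b)\<^sup>2))" for x :: "real^'n"
  proof -
    have "(\<Prod>b\<in>(Basis::(real^'n) set). 1 + (x \<bullet> b)\<^sup>2) \<le> (\<Prod>b\<in>(Basis::(real^'n) set). (1 + norm x)\<^sup>2)"
    proof (intro prod_mono conjI)
      fix b :: "real^'n" assume "b \<in> Basis"
      then have "(x \<bullet> b)\<^sup>2 \<le> (norm x)\<^sup>2"
        using Basis_le_norm[of b x] by (metis abs_ge_zero power2_abs power_mono)
      then show "1 + (x \<bullet> b)\<^sup>2 \<le> (1 + norm x)\<^sup>2"
        using norm_ge_zero[of x] by (simp add: power2_sum add_increasing2)
    qed simp
    also have "\<dots> = (1 + norm x) ^ (2 * CARD('n))" by (simp add: power_mult)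
    finally have "inverse ((1 + norm x) ^ (2 * CARD('n))) \<le> inverse (\<Prod>b\<in>Basis. 1 + (x \<bullet> b)\<^sup>2)"
      by (intro le_imp_inverse_le prod_pos) (auto simp: add_pos_nonneg)
    then show ?thesis
      using prod_inversef[of "\<lambda>b. 1 + (x \<bullet> b)\<^sup>2" Basis] by (simp add: decay_weight_def o_def)
  qed
  then have "(\<integral>\<^sup>+x. ennreal (decay_weight (2 * CARD('n)) (x :: real^'n)) \<partial>lborel)
      \<le> (\<integral>\<^sup>+x. (\<Prod>b\<in>Basis. ennreal (inverse (1 + ((x::real^'n) \<bullet> b)\<^sup>2))) \<partial>lborel)"
    by (intro nn_integral_mono) (simp add: prod_ennreal ennreal_leI)
  also have "\<dots> = (\<integral>\<^sup>+(x::real). ennreal (inverse (1 + x\<^sup>2)) \<partial>lborel) ^ CARD('n)"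
    using nn_integral_lborel_prod[where 'a="real^'n" and f = "\<lambda>_ x. ennreal (inverse (1 + x\<^sup>2))"] by simp
  also have "\<dots> < \<infinity>" using I by (simp add: power_less_top_ennreal)
  finally show ?thesis .
qed

text \<open>The coordinates of \<open>x\<close> are replaced by those of \<open>y\<close> one at a
  time, with the mean value inequality along each axis-parallel segment. Only partial derivatives
  occur, and no point visited is farther from \<open>x\<close> than \<open>y\<close> is.\<close>

lemma partial_derivative_bound:
  fixes f :: "real^'n \<Rightarrow> real"
  assumes der: "\<And>z i. ((\<lambda>h. f (z + h *\<^sub>R axis i 1)) has_field_derivative g i z) (at 0)"
    and bound: "\<And>z i. norm (z - x) \<le> norm (y - x) \<Longrightarrow> \<bar>g i z\<bar> \<le> L"
  shows "\<bar>f y - f x\<bar> \<le> real CARD('n) * (L * norm (y - x))"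
proof -
  define z where "z S = (\<chi> i. if i \<in> S then y $ i else x $ i)" for S :: "'n set"
  have "\<bar>f (z S) - f x\<bar> \<le> real (card S) * (L * norm (y - x))" for S
  proof (induction S rule: infinite_finite_induct)
    case (infinite S)
    then show ?case by simp
  next
    case empty
    then show ?case by (simp add: z_def)
  next
    case (insert k S)
    define d where "d = y $ k - x $ k"
    let ?p = "\<lambda>h. z S + h *\<^sub>R axis k 1"
    have zk: "z (insert k S) = ?p d"
      using insert by (auto simp: z_def d_def vec_eq_iff axis_def)
    have near: "norm (?p h - x) \<le> norm (y - x)" if "h \<in> closed_segment 0 d" for h
    proof (rule norm_le_componentwise_cart)
      fix i
      have "\<bar>h\<bar> \<le> \<bar>d\<bar>" using that segment_bound1[of h 0 d] by simp
      then show "norm ((?p h - x) $ i) \<le> norm ((y - x) $ i)"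
        using insert by (auto simp: z_def axis_def d_def)
    qed
    have "((\<lambda>h. f (?p h)) has_field_derivative g k (?p h)) (at h)" for h
    proof -
      have "((\<lambda>h'. f (?p (h' + h))) has_field_derivative g k (?p h)) (at 0)"
        using der[of "?p h" k] by (simp add: algebra_simps)
      then show ?thesis by (subst (asm) DERIV_shift[symmetric]) simp
    qed
    then have "norm (f (?p d) - f (?p 0)) \<le> L * norm (d - 0)"
      using bound[OF near]
      by (intro field_differentiable_bound[where S="closed_segment 0 d" and f="\<lambda>h. f (?p h)" and f'="\<lambda>h. g k (?p h)"])
        (auto intro: has_field_derivative_at_within)
    also have "\<dots> \<le> L * norm (y - x)"
      \<comment> \<open>The derivative bound at \<open>x\<close> itself supplies the nonnegativity
        of \<open>L\<close>.\<close>
      using component_le_norm_cart[of "y - x" k] bound[of x k]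
      by (intro mult_left_mono) (auto simp: d_def)
    finally have "\<bar>f (z (insert k S)) - f (z S)\<bar> \<le> L * norm (y - x)" by (simp add: zk)
    then show ?case using insert by (simp add: distrib_right)
  qed
  moreover have "z UNIV = y" by (simp add: z_def vec_eq_iff)
  ultimately show ?thesis by metis
qed

lemma schwartz_decay:
  assumes "schwartz f"
  shows "\<exists>c. \<forall>x. \<bar>pderivs is f x\<bar> \<le> c * decay_weight m x"
proof -
  have "bounded (range (\<lambda>x. (1 + norm x) ^ m * pderivs is f x))"
    using assms by (auto simp: schwartz_def)
  then obtain c where c: "\<And>x. \<bar>(1 + norm x) ^ m * pderivs is f x\<bar> \<le> c"
    by (auto simp: bounded_iff)
  have "\<bar>pderivs is f x\<bar> \<le> c * decay_weight m x" for x
    using c[of x] by (simp add: decay_weight_def abs_mult field_simps add_pos_nonneg)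
  then show ?thesis by blast
qed

lemma schwartz_has_partial_derivative:
  assumes "schwartz f"
  shows "((\<lambda>h. f (z + h *\<^sub>R axis i 1)) has_field_derivative pderivs [i] f z) (at 0)"
proof -
  have "(\<lambda>h. pderivs [] f (z + h *\<^sub>R axis i 1)) differentiable (at 0)"
    using assms unfolding schwartz_def by blast
  then show ?thesis
    by (simp add: partial_d_def DERIV_deriv_iff_real_differentiable)
qed

text \<open>At distance at most 1 the decay of the first derivatives is transferred to the endpoint
  \<open>x\<close>. At larger distance the two values are bounded separately, and the factor
  \<open>norm (y - x)\<close> exceeds 1.\<close>

lemma schwartz_lipschitz:
  fixes f :: "real^'n \<Rightarrow> real"
  assumes f: "schwartz f"
  obtains c where "c \<ge> 0" "\<And>x y. \<bar>f y - f x\<bar> \<le> c * norm (y - x) * (decay_weight m x + decay_weight m y)"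
proof -
  obtain c0 where c0: "\<And>x. \<bar>f x\<bar> \<le> c0 * decay_weight m x"
    using schwartz_decay[OF f, of "[]" m] by auto
  obtain c1 where c1: "\<And>i x. \<bar>pderivs [i] f x\<bar> \<le> c1 i * decay_weight m x"
    using schwartz_decay[OF f, of "[_]" m] by metis
  define b where "b = (\<Sum>i\<in>UNIV. \<bar>c1 i\<bar>)"
  have b: "\<bar>pderivs [i] f x\<bar> \<le> b * decay_weight m x" for i x
  proof -
    have "c1 i \<le> \<bar>c1 i\<bar>" by simp
    also have "\<dots> \<le> b" unfolding b_def by (intro member_le_sum) auto
    finally show ?thesis
      using c1[of i x] decay_weight_pos[of m x] by (meson mult_right_mono less_imp_le order_trans)
  qed
  have b0: "0 \<le> b" by (simp add: b_def sum_nonneg)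
  have c0': "0 \<le> c0" using c0[of 0] decay_weight_pos[of m "0 :: real^'n"] by (metis abs_ge_zero order_trans zero_le_mult_iff not_le)
  let ?c = "c0 + real CARD('n) * (b * 2 ^ m)"
  show ?thesis
  proof (rule that[of ?c])
    show "0 \<le> ?c" using b0 c0' by simp
    fix x y :: "real^'n"
    have wx: "0 < decay_weight m x" and wy: "0 < decay_weight m y" by (rule decay_weight_pos)+
    show "\<bar>f y - f x\<bar> \<le> ?c * norm (y - x) * (decay_weight m x + decay_weight m y)"
    proof (cases "norm (y - x) \<le> 1")
      case True
      have "\<bar>pderivs [i] f z\<bar> \<le> b * (2 ^ m * decay_weight m x)" if "norm (z - x) \<le> norm (y - x)" for z i
        using b[of i z] mult_left_mono[OF decay_weight_nearby[of z x m] b0] that True by linarith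
      from partial_derivative_bound[OF schwartz_has_partial_derivative[OF f] this]
      have "\<bar>f y - f x\<bar> \<le> real CARD('n) * (b * (2 ^ m * decay_weight m x) * norm (y - x))" by simp
      also have "\<dots> = real CARD('n) * (b * 2 ^ m) * (norm (y - x) * decay_weight m x)" by simp
      also have "\<dots> \<le> ?c * (norm (y - x) * (decay_weight m x + decay_weight m y))"
        using c0' b0 wx wy by (intro mult_mono mult_left_mono) auto
      finally show ?thesis by (simp add: ac_simps)
    next
      case False
      have "\<bar>f y - f x\<bar> \<le> c0 * (decay_weight m x + decay_weight m y)"
        using c0[of x] c0[of y] by (simp add: distrib_left)
      also have "\<dots> \<le> (?c * norm (y - x)) * (decay_weight m x + decay_weight m y)"
      proof (intro mult_right_mono)
        have "c0 * 1 \<le> ?c * norm (y - x)" using False c0' b0 by (intro mult_mono) auto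
        then show "c0 \<le> ?c * norm (y - x)" by simp
      qed (use wx wy in auto)
      finally show ?thesis .
    qed
  qed
qed

lemma schwartz_continuous: "schwartz f \<Longrightarrow> continuous_on UNIV f"
  unfolding schwartz_def by (metis pderivs.simps(1))

lemma schwartz_borel_measurable: "schwartz f \<Longrightarrow> f \<in> borel_measurable borel"
  by (intro borel_measurable_continuous_onI schwartz_continuous)

lemma schwartz_integrable:
  fixes f :: "real^'n \<Rightarrow> real"
  assumes f: "schwartz f"
  shows "integrable lborel f"
proof (rule integrableI_bounded)
  show "f \<in> borel_measurable lborel" using schwartz_borel_measurable[OF f] by simp
  obtain c where c: "\<And>x. \<bar>f x\<bar> \<le> c * decay_weight (2 * CARD('n)) x"
    using schwartz_decay[OF f, of "[]"] by auto
  have "(\<integral>\<^sup>+x. ennreal (norm (f x)) \<partial>lborel) \<le> (\<integral>\<^sup>+(x::real^'n). ennreal \<bar>c\<bar> * ennreal (decay_weight (2 * CARD('n)) x) \<partial>lborel)"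
  proof (intro nn_integral_mono)
    fix x :: "real^'n"
    have "\<bar>f x\<bar> \<le> \<bar>c\<bar> * decay_weight (2 * CARD('n)) x"
      using c[of x] decay_weight_pos[of _ x] by (meson abs_ge_self less_imp_le mult_right_mono order_trans)
    then show "ennreal (norm (f x)) \<le> ennreal \<bar>c\<bar> * ennreal (decay_weight (2 * CARD('n)) x)"
      by (simp add: ennreal_mult'[symmetric] ennreal_leI)
  qed
  also have "\<dots> < \<infinity>"
    using nn_integral_decay_weight_finite[where 'n='n] by (simp add: nn_integral_cmult ennreal_mult_less_top)
  finally show "(\<integral>\<^sup>+x. ennreal (norm (f x)) \<partial>lborel) < \<infinity>" .
qed

section \<open>How fast the semigroup departs from the identity on Schwartz functions\<close>

context kolmogorov
begin

lemma nn_integral_flow_le: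
  fixes h :: "real^'n \<Rightarrow> ennreal"
  assumes [measurable]: "h \<in> borel_measurable borel" and u: "u \<ge> 0"
  shows "(\<integral>\<^sup>+X. h (w + flow u *v X) \<partial>lborel) \<le> (\<integral>\<^sup>+X. h X \<partial>lborel)"
proof -
  have "det (flow u) \<ge> 1" using det_mexp_ge_1[OF B_trace u] by (simp add: flow_def)
  then have "1 * (\<integral>\<^sup>+X. h (w + flow u *v X) \<partial>lborel) \<le> ennreal \<bar>det (flow u)\<bar> * (\<integral>\<^sup>+X. h (w + flow u *v X) \<partial>lborel)"
    by (intro mult_right_mono) auto
  also have "\<dots> = (\<integral>\<^sup>+X. h (w + X) \<partial>lborel)"
    using det_flow[of u] by (intro nn_integral_lborel_linear) auto
  also have "\<dots> = (\<integral>\<^sup>+X. h X \<partial>lborel)" by (rule nn_integral_lborel_plus) measurable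
  finally show ?thesis by simp
qed

lemma nn_integral_heat_kernel_shift:
  fixes h :: "real^'n \<Rightarrow> ennreal"
  assumes [measurable]: "h \<in> borel_measurable borel" and t: "t > 0"
  shows "(\<integral>\<^sup>+Y. ennreal (heat_kernel Q B X Y t) * h Y \<partial>lborel) = (\<integral>\<^sup>+w. ennreal (gauss (C t) w) * h (w + flow t *v X) \<partial>lborel)"
  using nn_integral_lborel_plus[of "\<lambda>Y. ennreal (heat_kernel Q B X Y t) * h Y" "flow t *v X"]
  by (simp add: heat_kernel_eq_gauss[OF t] add.commute)

text \<open>The increment splits into a random displacement \<open>w\<close> from the transported
  point, of mean size \<open>sqrt u\<close>, and the drift from \<open>X\<close> to that point, of
  size \<open>u * norm X\<close>. The linear growth of the drift is paid for by the decay of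
  \<open>f\<close>.\<close>

lemma heat_kernel_modulus_small_time:
  fixes f :: "real^'n \<Rightarrow> real"
  assumes f: "schwartz f"
  obtains c where "c \<ge> 0" "\<And>u. 0 < u \<Longrightarrow> u \<le> 1 \<Longrightarrow>
    (\<integral>\<^sup>+X. \<integral>\<^sup>+Y. ennreal (heat_kernel Q B X Y u) * ennreal \<bar>f Y - f X\<bar> \<partial>lborel \<partial>lborel) \<le> ennreal (c * sqrt u)"
proof -
  note [measurable] = schwartz_borel_measurable[OF f]
  let ?m = "2 * CARD('n)"
  \<comment> \<open>\<open>?V\<close> is integrable; \<open>?W\<close> decays by one more power, to
    be spent on the factor \<open>norm X\<close> of the drift.\<close>
  let ?V = "decay_weight ?m :: real^'n \<Rightarrow> real" and ?W = "decay_weight (Suc ?m) :: real^'n \<Rightarrow> real"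
  obtain c0 where c0: "c0 \<ge> 0" "\<And>x y. \<bar>f y - f x\<bar> \<le> c0 * norm (y - x) * (?W x + ?W y)"
    using schwartz_lipschitz[OF f] by blast
  obtain c1 where c1: "c1 > 0" "\<And>r x. r \<in> {-1..1} \<Longrightarrow> norm (flow r *v x) \<le> c1 * norm x"
    using mexp_bounded[of B] unfolding flow_def by blast
  obtain c2 where c2: "c2 > 0" "\<And>u x. u \<in> {0..1} \<Longrightarrow> norm (flow u *v x - x) \<le> c2 * u * norm x"
    using mexp_diff_bounded[of B] unfolding flow_def by blast
  obtain c3 where c3: "c3 > 0" "\<And>u. u \<in> {0..1} \<Longrightarrow> trace (C u) \<le> c3 * u"
    using trace_cov_le[of Q B] by blast
  obtain v where v: "v \<ge> 0" "(\<integral>\<^sup>+x. ennreal (?V x) \<partial>lborel) = ennreal v"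
    using nn_integral_decay_weight_finite[where 'n='n] by (cases "\<integral>\<^sup>+x. ennreal (?V x) \<partial>lborel") auto
  obtain g where g: "g \<ge> 0" "gauss_moment TYPE('n) = ennreal g"
    using gauss_moment_finite[where 'n='n] by (cases "gauss_moment TYPE('n)") auto
  have V0: "0 \<le> ?V x" for x using decay_weight_pos[of ?m x] by simp
  have W0: "0 \<le> ?W x" for x using decay_weight_pos[of "Suc ?m" x] by simp
  define A where "A = c0 * (2 * v)"
  define D where "D = c0 * c2 * (c1 * v + v)"
  have A0: "0 \<le> A" and D0: "0 \<le> D" using c0 c1 c2 v by (simp_all add: A_def D_def)
  \<comment> \<open>The summand \<open>0 +\<close> gives both transported weights the same shape, so
    that \<open>i1\<close> below applies with \<open>w' = 0\<close>.\<close>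
  have pointwise: "\<bar>f (w + flow u *v X) - f X\<bar> \<le> c0 * norm w * (?V (w + flow u *v X) + ?V (0 + flow u *v X))
      + c0 * c2 * u * (c1 * ?V (0 + flow u *v X) + ?V X)" if u: "0 < u" "u \<le> 1" for u w X
  proof -
    let ?e = "flow u *v X"
    have "\<bar>f (w + ?e) - f ?e\<bar> \<le> c0 * norm w * (?W ?e + ?W (w + ?e))"
      using c0(2)[of "w + ?e" ?e] by simp
    also have "\<dots> \<le> c0 * norm w * (?V ?e + ?V (w + ?e))"
      using c0 by (intro mult_left_mono add_mono decay_weight_Suc_le) auto
    finally have 1: "\<bar>f (w + ?e) - f ?e\<bar> \<le> c0 * norm w * (?V (w + ?e) + ?V ?e)" by (simp add: add.commute)
    \<comment> \<open>In the drift term the weight sits at the transported point, so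
      \<open>norm X\<close> is compared with the norm there by flowing back for time
      \<open>u\<close>.\<close>
    have nX: "norm X \<le> c1 * norm ?e"
      using c1(2)[of "- u" ?e] u by (simp add: flow_inverse)
    have "\<bar>f ?e - f X\<bar> \<le> c0 * norm (?e - X) * (?W X + ?W ?e)" by (rule c0(2))
    also have "\<dots> \<le> c0 * (c2 * u * norm X) * (?W X + ?W ?e)"
      using c0 c2(2)[of u X] u W0 by (intro mult_right_mono mult_left_mono) auto
    also have "\<dots> = c0 * c2 * u * (norm X * ?W X + norm X * ?W ?e)" by (simp add: algebra_simps)
    also have "\<dots> \<le> c0 * c2 * u * (?V X + c1 * ?V ?e)"
    proof (intro mult_left_mono add_mono norm_decay_weight_Suc_le)
      have "norm X * ?W ?e \<le> c1 * norm ?e * ?W ?e" using nX W0 by (intro mult_right_mono) auto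
      also have "\<dots> \<le> c1 * ?V ?e"
        using c1 norm_decay_weight_Suc_le[of ?e ?m] by (simp add: mult.assoc)
      finally show "norm X * ?W ?e \<le> c1 * ?V ?e" .
    qed (use c0 c2 u in auto)
    finally have "\<bar>f ?e - f X\<bar> \<le> c0 * c2 * u * (c1 * ?V ?e + ?V X)" by (simp add: add.commute)
    with 1 show ?thesis by simp
  qed
  have inner: "(\<integral>\<^sup>+X. ennreal \<bar>f (w + flow u *v X) - f X\<bar> \<partial>lborel) \<le> ennreal A * ennreal (norm w) + ennreal (D * u)"
    if u: "0 < u" "u \<le> 1" for u w
  proof -
    have i1: "(\<integral>\<^sup>+X. ennreal (?V (w' + flow u *v X)) \<partial>lborel) \<le> ennreal v" for w'
      using nn_integral_flow_le[of "\<lambda>x. ennreal (?V x)" u w'] u v by simp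
    let ?k1 = "ennreal (c0 * norm w)" and ?k2 = "ennreal (c0 * c2 * u)"
    have "(\<integral>\<^sup>+X. ennreal \<bar>f (w + flow u *v X) - f X\<bar> \<partial>lborel) \<le>
      (\<integral>\<^sup>+X. ?k1 * (ennreal (?V (w + flow u *v X)) + ennreal (?V (0 + flow u *v X)))
         + ?k2 * (ennreal c1 * ennreal (?V (0 + flow u *v X)) + ennreal (?V X)) \<partial>lborel)"
      using pointwise[OF u, of w] c0 c1 c2 u V0
      by (intro nn_integral_mono) (simp add: ennreal_leI flip: ennreal_mult ennreal_plus)
    also have "\<dots> = ?k1 * ((\<integral>\<^sup>+X. ennreal (?V (w + flow u *v X)) \<partial>lborel) + (\<integral>\<^sup>+X. ennreal (?V (0 + flow u *v X)) \<partial>lborel))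
         + ?k2 * (ennreal c1 * (\<integral>\<^sup>+X. ennreal (?V (0 + flow u *v X)) \<partial>lborel) + (\<integral>\<^sup>+X. ennreal (?V X) \<partial>lborel))"
      by (simp add: nn_integral_add nn_integral_cmult)
    also have "\<dots> \<le> ?k1 * (ennreal v + ennreal v) + ?k2 * (ennreal c1 * ennreal v + ennreal v)"
      using v by (intro add_mono mult_left_mono i1) auto
    also have "\<dots> = ennreal A * ennreal (norm w) + ennreal (D * u)"
      using c0 c1 c2 v u by (simp add: A_def D_def algebra_simps flip: ennreal_mult ennreal_plus)
    finally show ?thesis .
  qed
  show ?thesis
  proof (rule that[of "A * (sqrt c3 * g) + D"])
    show "0 \<le> A * (sqrt c3 * g) + D" using A0 D0 c3 g by simp
    fix u :: real assume u: "0 < u" "u \<le> 1"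
    have "(\<integral>\<^sup>+X. \<integral>\<^sup>+Y. ennreal (heat_kernel Q B X Y u) * ennreal \<bar>f Y - f X\<bar> \<partial>lborel \<partial>lborel)
      = (\<integral>\<^sup>+X. \<integral>\<^sup>+w. ennreal (gauss (C u) w) * ennreal \<bar>f (w + flow u *v X) - f X\<bar> \<partial>lborel \<partial>lborel)"
      by (intro nn_integral_cong nn_integral_heat_kernel_shift u) measurable
    also have "\<dots> = (\<integral>\<^sup>+w. \<integral>\<^sup>+X. ennreal (gauss (C u) w) * ennreal \<bar>f (w + flow u *v X) - f X\<bar> \<partial>lborel \<partial>lborel)"
      by (rule lborel_pair.Fubini') measurable
    also have "\<dots> = (\<integral>\<^sup>+w. ennreal (gauss (C u) w) * (\<integral>\<^sup>+X. ennreal \<bar>f (w + flow u *v X) - f X\<bar> \<partial>lborel) \<partial>lborel)"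
      by (intro nn_integral_cong nn_integral_cmult) measurable
    also have "\<dots> \<le> (\<integral>\<^sup>+w. ennreal (gauss (C u) w) * (ennreal A * ennreal (norm w) + ennreal (D * u)) \<partial>lborel)"
      by (intro nn_integral_mono mult_left_mono inner u) auto
    also have "\<dots> = (\<integral>\<^sup>+w. ennreal A * (ennreal (gauss (C u) w) * ennreal (norm w)) + ennreal (D * u) * ennreal (gauss (C u) w) \<partial>lborel)"
      by (simp add: algebra_simps)
    also have "\<dots> = ennreal A * (\<integral>\<^sup>+w. ennreal (gauss (C u) w) * ennreal (norm w) \<partial>lborel) + ennreal (D * u)"
      using nn_integral_gauss[OF cov_sym cov_pos_def[OF u(1)]]
      by (simp add: nn_integral_add nn_integral_cmult)
    also have "\<dots> \<le> ennreal A * (ennreal (sqrt (c3 * u)) * ennreal g) + ennreal (D * sqrt u)"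
    proof (intro add_mono mult_left_mono ennreal_leI)
      have "(\<integral>\<^sup>+w. ennreal (gauss (C u) w) * ennreal (norm w) \<partial>lborel) \<le> ennreal (sqrt (trace (C u))) * ennreal g"
        using nn_integral_gauss_norm[OF cov_sym cov_pos_def[OF u(1)]] g by simp
      also have "\<dots> \<le> ennreal (sqrt (c3 * u)) * ennreal g"
        using c3(2)[of u] u by (intro mult_right_mono ennreal_leI) auto
      finally show "(\<integral>\<^sup>+w. ennreal (gauss (C u) w) * ennreal (norm w) \<partial>lborel) \<le> ennreal (sqrt (c3 * u)) * ennreal g" .
      have "u * u \<le> 1 * u" using u by (intro mult_right_mono) auto
      then show "u \<le> sqrt u" using u by (intro real_le_rsqrt) (simp add: power2_eq_square)
    qed (use D0 in auto)
    also have "\<dots> = ennreal ((A * (sqrt c3 * g) + D) * sqrt u)"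
      using A0 D0 c3 g u by (simp add: real_sqrt_mult algebra_simps flip: ennreal_mult ennreal_plus)
    finally show "(\<integral>\<^sup>+X. \<integral>\<^sup>+Y. ennreal (heat_kernel Q B X Y u) * ennreal \<bar>f Y - f X\<bar> \<partial>lborel \<partial>lborel) \<le> ennreal ((A * (sqrt c3 * g) + D) * sqrt u)" .
  qed
qed

section \<open>The fractional power\<close>

lemma borel_measurable_heat_kernel_compose:
  assumes [measurable]: "T \<in> borel_measurable M" "F \<in> borel_measurable M" "G \<in> borel_measurable M"
  shows "(\<lambda>x. if 0 < T x then heat_kernel Q B (F x) (G x) (T x) else 0) \<in> borel_measurable M"
proof -
  have "(\<lambda>x. (T x, F x, G x)) \<in> M \<rightarrow>\<^sub>M (borel \<Otimes>\<^sub>M borel \<Otimes>\<^sub>M borel)" by measurable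
  from measurable_compose[OF this borel_measurable_heat_kernel] show ?thesis by simp
qed

lemma borel_measurable_heat_kernel_fixed:
  assumes t: "0 < t" and "F \<in> borel_measurable M" "G \<in> borel_measurable M"
  shows "(\<lambda>x. heat_kernel Q B (F x) (G x) t) \<in> borel_measurable M"
  using borel_measurable_heat_kernel_compose[of "\<lambda>_. t" M F G] assms by simp

lemma integrable_heat_kernel_mult:
  fixes f :: "real^'n \<Rightarrow> real"
  assumes f: "integrable lborel f" and t: "0 < t"
  shows "integrable lborel (\<lambda>Y. heat_kernel Q B X Y t * f Y)"
proof -
  note [measurable] = borel_measurable_heat_kernel_fixed[OF t] borel_measurable_integrable[OF f]
  let ?k = "(4 * pi) powr (- real CARD('n) / 2) * det (C t) powr (-1/2)"
  show ?thesis
  proof (rule Bochner_Integration.integrable_bound)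
    show "integrable lborel (\<lambda>Y. ?k * f Y)" using f by simp
    show "(\<lambda>Y. heat_kernel Q B X Y t * f Y) \<in> borel_measurable lborel" by measurable
    show "AE Y in lborel. norm (heat_kernel Q B X Y t * f Y) \<le> norm (?k * f Y)"
      using heat_kernel_le[OF t, of X] heat_kernel_nonneg[OF t, of X]
      by (auto simp: abs_mult intro!: AE_I2 mult_right_mono)
  qed
qed

lemma integrable_heat_kernel:
  assumes t: "0 < t"
  shows "integrable lborel (\<lambda>Y. heat_kernel Q B X Y t)" "(\<integral>Y. heat_kernel Q B X Y t \<partial>lborel) = 1"
proof -
  note [measurable] = borel_measurable_heat_kernel_fixed[OF t]
  show i: "integrable lborel (\<lambda>Y. heat_kernel Q B X Y t)"
    using nn_integral_heat_kernel_right[OF t, of X] heat_kernel_nonneg[OF t, of X]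
    by (intro integrableI_bounded) auto
  show "(\<integral>Y. heat_kernel Q B X Y t \<partial>lborel) = 1"
    using nn_integral_heat_kernel_right[OF t, of X] heat_kernel_nonneg[OF t, of X]
    by (subst integral_eq_nn_integral) auto
qed

text \<open>Keeping the absolute value inside the inner integral gives a nonnegative double
  integral, open to Tonelli, that dominates the L1 norm of the semigroup increment and the
  increments of the dual pairing.\<close>

definition kernel_modulus :: "(real^'n \<Rightarrow> real) \<Rightarrow> real \<Rightarrow> ennreal" where
  "kernel_modulus f u = (\<integral>\<^sup>+X. \<integral>\<^sup>+Y. ennreal (heat_kernel Q B X Y u) * ennreal \<bar>f Y - f X\<bar> \<partial>lborel \<partial>lborel)"

text \<open>Mass one in the second variable lets \<open>f X\<close> be written as a kernel average,
  so the difference becomes an average of increments of \<open>f\<close>.\<close>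

lemma nn_integral_semigroup_diff_le:
  fixes f :: "real^'n \<Rightarrow> real"
  assumes f: "integrable lborel f" and u: "0 < u"
  shows "(\<integral>\<^sup>+X. ennreal \<bar>semigroup Q B u f X - f X\<bar> \<partial>lborel) \<le> kernel_modulus f u"
  unfolding kernel_modulus_def
proof (intro nn_integral_mono)
  fix X :: "real^'n"
  note [measurable] = borel_measurable_heat_kernel_fixed[OF u] borel_measurable_integrable[OF f]
  have i: "integrable lborel (\<lambda>Y. heat_kernel Q B X Y u * f Y)" "integrable lborel (\<lambda>Y. heat_kernel Q B X Y u * f X)"
    using integrable_heat_kernel_mult[OF f u] integrable_heat_kernel[OF u] by auto
  have "semigroup Q B u f X - f X = (\<integral>Y. heat_kernel Q B X Y u * (f Y - f X) \<partial>lborel)"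
    unfolding semigroup_def right_diff_distrib
    by (subst Bochner_Integration.integral_diff[OF i]) (simp add: integrable_heat_kernel[OF u])
  also have "ennreal (norm \<dots>) \<le> (\<integral>\<^sup>+Y. ennreal (norm (heat_kernel Q B X Y u * (f Y - f X))) \<partial>lborel)"
    by (rule integral_norm_bound_ennreal) (use i in \<open>simp add: right_diff_distrib\<close>)
  finally show "ennreal \<bar>semigroup Q B u f X - f X\<bar> \<le> (\<integral>\<^sup>+Y. ennreal (heat_kernel Q B X Y u) * ennreal \<bar>f Y - f X\<bar> \<partial>lborel)"
    using heat_kernel_nonneg[OF u] by (simp add: abs_mult ennreal_mult)
qed

lemma nn_integral_heat_kernel_mult_le:
  fixes h :: "real^'n \<Rightarrow> ennreal"
  assumes [measurable]: "h \<in> borel_measurable borel" and u: "0 < u"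
  shows "(\<integral>\<^sup>+X. \<integral>\<^sup>+Y. ennreal (heat_kernel Q B X Y u) * h Y \<partial>lborel \<partial>lborel) \<le> (\<integral>\<^sup>+Y. h Y \<partial>lborel)"
proof -
  note [measurable] = borel_measurable_heat_kernel_fixed[OF u]
  have "(\<integral>\<^sup>+X. \<integral>\<^sup>+Y. ennreal (heat_kernel Q B X Y u) * h Y \<partial>lborel \<partial>lborel) =
     (\<integral>\<^sup>+Y. \<integral>\<^sup>+X. ennreal (heat_kernel Q B X Y u) * h Y \<partial>lborel \<partial>lborel)"
    by (rule lborel_pair.Fubini') measurable
  also have "\<dots> = (\<integral>\<^sup>+Y. (\<integral>\<^sup>+X. ennreal (heat_kernel Q B X Y u) \<partial>lborel) * h Y \<partial>lborel)"
    by (intro nn_integral_cong nn_integral_multc) measurable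
  also have "\<dots> \<le> (\<integral>\<^sup>+Y. 1 * h Y \<partial>lborel)"
    by (intro nn_integral_mono mult_right_mono nn_integral_heat_kernel_left[OF u]) auto
  finally show ?thesis by simp
qed

lemma kernel_modulus_le:
  fixes f :: "real^'n \<Rightarrow> real"
  assumes f: "f \<in> borel_measurable borel" and u: "0 < u"
  shows "kernel_modulus f u \<le> 2 * (\<integral>\<^sup>+X. ennreal \<bar>f X\<bar> \<partial>lborel)"
proof -
  note [measurable] = borel_measurable_heat_kernel_fixed[OF u] f
  have "kernel_modulus f u \<le> (\<integral>\<^sup>+X. \<integral>\<^sup>+Y. ennreal (heat_kernel Q B X Y u) * ennreal \<bar>f Y\<bar> + ennreal (heat_kernel Q B X Y u) * ennreal \<bar>f X\<bar> \<partial>lborel \<partial>lborel)"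
    unfolding kernel_modulus_def
    by (intro nn_integral_mono) (auto simp flip: distrib_left ennreal_plus intro!: mult_left_mono ennreal_leI)
  also have "\<dots> = (\<integral>\<^sup>+X. \<integral>\<^sup>+Y. ennreal (heat_kernel Q B X Y u) * ennreal \<bar>f Y\<bar> \<partial>lborel \<partial>lborel) + (\<integral>\<^sup>+X. ennreal \<bar>f X\<bar> \<partial>lborel)"
    by (simp add: nn_integral_add nn_integral_multc nn_integral_heat_kernel_right[OF u])
  also have "\<dots> \<le> (\<integral>\<^sup>+X. ennreal \<bar>f X\<bar> \<partial>lborel) + (\<integral>\<^sup>+X. ennreal \<bar>f X\<bar> \<partial>lborel)"
    by (intro add_mono nn_integral_heat_kernel_mult_le u) auto
  finally show ?thesis by (simp add: mult_2)
qed

lemma borel_measurable_semigroup: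
  fixes f :: "real^'n \<Rightarrow> real"
  assumes u: "0 < u" and [measurable]: "f \<in> borel_measurable borel"
  shows "semigroup Q B u f \<in> borel_measurable borel"
proof -
  have "(\<lambda>z. heat_kernel Q B (fst z) (snd z) u * f (snd z)) \<in> borel_measurable (lborel \<Otimes>\<^sub>M lborel)"
    by (intro borel_measurable_times borel_measurable_heat_kernel_fixed[OF u]) measurable
  then have "(\<lambda>X. \<integral>Y. heat_kernel Q B X Y u * f Y \<partial>lborel) \<in> borel_measurable lborel"
    by (intro lborel.borel_measurable_lebesgue_integral) (simp add: case_prod_beta')
  then show ?thesis by (simp add: semigroup_def[abs_def])
qed

lemma borel_measurable_semigroup_joint:
  fixes f :: "real^'n \<Rightarrow> real"
  assumes [measurable]: "f \<in> borel_measurable borel"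
  shows "(\<lambda>z. indicator {0<..} (fst z) * (fst z powr (-1 - s) * (semigroup Q B (fst z) f (snd z) - f (snd z))))
    \<in> borel_measurable (lborel \<Otimes>\<^sub>M lborel)"
proof -
  have [measurable]: "(\<lambda>z. (if 0 < fst (fst z) then heat_kernel Q B (snd (fst z)) (snd z) (fst (fst z)) else 0) * f (snd z))
     \<in> borel_measurable ((lborel \<Otimes>\<^sub>M lborel) \<Otimes>\<^sub>M lborel)"
    by (intro borel_measurable_times borel_measurable_heat_kernel_compose) measurable
  have "(\<lambda>z. \<integral>Y. (if 0 < fst z then heat_kernel Q B (snd z) Y (fst z) else 0) * f Y \<partial>lborel) \<in> borel_measurable (lborel \<Otimes>\<^sub>M lborel)"
    by (rule lborel.borel_measurable_lebesgue_integral) (simp add: case_prod_beta')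
  then have "(\<lambda>z. indicator {0<..} (fst z) * (fst z powr (-1 - s) *
      ((\<integral>Y. (if 0 < fst z then heat_kernel Q B (snd z) Y (fst z) else 0) * f Y \<partial>lborel) - f (snd z))))
    \<in> borel_measurable (lborel \<Otimes>\<^sub>M lborel)"
    by measurable
  then show ?thesis
    by (rule measurable_cong[THEN iffD1, rotated]) (auto simp: semigroup_def indicator_def)
qed

text \<open>Near 0 the modulus bound turns the weight into \<open>u powr (-1/2 - s)\<close>,
  integrable because \<open>s < 1/2\<close>; beyond 1 the L1 contraction bound leaves the tail of
  \<open>u powr (-1 - s)\<close>.\<close>

lemma integrable_fractional_integrand:
  fixes f \<psi> :: "real^'n \<Rightarrow> real"
  assumes f: "schwartz f" and s: "0 < s" "s < 1/2"
    and \<psi>[measurable]: "\<psi> \<in> borel_measurable borel" and \<psi>1: "\<And>x. \<bar>\<psi> x\<bar> \<le> 1"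
  shows "integrable (lborel \<Otimes>\<^sub>M lborel) (\<lambda>z. indicator {0<..} (fst z) *
    (fst z powr (-1 - s) * (semigroup Q B (fst z) f (snd z) - f (snd z))) * \<psi> (snd z))"
proof (rule integrableI_bounded)
  note [measurable] = schwartz_borel_measurable[OF f]
  note meas = borel_measurable_semigroup_joint[OF schwartz_borel_measurable[OF f], of s]
  note [measurable] = meas
  note fi = schwartz_integrable[OF f]
  let ?H = "\<lambda>z. indicator {0<..} (fst z) * (fst z powr (-1 - s) * (semigroup Q B (fst z) f (snd z) - f (snd z))) * \<psi> (snd z)"
  show m: "?H \<in> borel_measurable (lborel \<Otimes>\<^sub>M lborel)" by measurable
  obtain c where c: "c \<ge> 0" "\<And>u. 0 < u \<Longrightarrow> u \<le> 1 \<Longrightarrow> kernel_modulus f u \<le> ennreal (c * sqrt u)"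
    using heat_kernel_modulus_small_time[OF f] unfolding kernel_modulus_def by blast
  obtain b where b: "b \<ge> 0" "(\<integral>\<^sup>+X. ennreal \<bar>f X\<bar> \<partial>lborel) = ennreal b"
    using fi by (cases "\<integral>\<^sup>+X. ennreal \<bar>f X\<bar> \<partial>lborel") (auto simp: integrable_iff_bounded)
  \<comment> \<open>Both indicators are 1 at \<open>u = 1\<close>, which is harmless in an upper
    bound.\<close>
  have slice: "(\<integral>\<^sup>+X. ennreal (norm (?H (u, X))) \<partial>lborel) \<le>
      ennreal c * ennreal (indicator {0..1} u * u powr (-1/2 - s)) + ennreal (2 * b) * ennreal (indicator {1..} u * u powr (-1 - s))" for u
  proof (cases "0 < u")
    case False
    then show ?thesis by simp
  next
    case True
    have "(\<integral>\<^sup>+X. ennreal (norm (?H (u, X))) \<partial>lborel) \<le> (\<integral>\<^sup>+X. ennreal (u powr (-1 - s)) * ennreal \<bar>semigroup Q B u f X - f X\<bar> \<partial>lborel)"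
    proof (intro nn_integral_mono)
      fix X
      have "norm (?H (u, X)) = (u powr (-1 - s) * \<bar>semigroup Q B u f X - f X\<bar>) * \<bar>\<psi> X\<bar>"
        using True by (simp add: abs_mult)
      also have "\<dots> \<le> (u powr (-1 - s) * \<bar>semigroup Q B u f X - f X\<bar>) * 1"
        using \<psi>1 by (intro mult_left_mono) auto
      finally show "ennreal (norm (?H (u, X))) \<le> ennreal (u powr (-1 - s)) * ennreal \<bar>semigroup Q B u f X - f X\<bar>"
        by (simp add: ennreal_leI flip: ennreal_mult)
    qed
    also have "\<dots> = ennreal (u powr (-1 - s)) * (\<integral>\<^sup>+X. ennreal \<bar>semigroup Q B u f X - f X\<bar> \<partial>lborel)"
      using borel_measurable_semigroup[OF True schwartz_borel_measurable[OF f]] schwartz_borel_measurable[OF f]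
      by (intro nn_integral_cmult) simp
    also have "\<dots> \<le> ennreal (u powr (-1 - s)) * kernel_modulus f u"
      by (intro mult_left_mono nn_integral_semigroup_diff_le[OF fi True]) simp
    also have "\<dots> \<le> ennreal c * ennreal (indicator {0..1} u * u powr (-1/2 - s)) + ennreal (2 * b) * ennreal (indicator {1..} u * u powr (-1 - s))"
    proof (cases "u \<le> 1")
      case u1: True
      have "u powr (-1 - s) * (c * sqrt u) = c * u powr (-1/2 - s)"
        using True by (simp add: powr_half_sqrt[symmetric] mult.left_commute powr_add[symmetric])
      then have "ennreal (u powr (-1 - s)) * ennreal (c * sqrt u) = ennreal c * ennreal (indicator {0..1} u * u powr (-1/2 - s))"
        using True u1 c by (simp flip: ennreal_mult)
      then show ?thesis
        using mult_left_mono[OF c(2)[OF True u1], of "ennreal (u powr (-1 - s))"]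
        by (simp add: add_increasing2)
    next
      case u1: False
      have "ennreal (u powr (-1 - s)) * kernel_modulus f u \<le> ennreal (u powr (-1 - s)) * (2 * ennreal b)"
        using kernel_modulus_le[OF schwartz_borel_measurable[OF f] True] b by (intro mult_left_mono) auto
      then show ?thesis using u1 b by (simp add: ennreal_mult mult.commute)
    qed
    finally show ?thesis .
  qed
  have "(\<integral>\<^sup>+z. ennreal (norm (?H z)) \<partial>(lborel \<Otimes>\<^sub>M lborel)) = (\<integral>\<^sup>+u. \<integral>\<^sup>+X. ennreal (norm (?H (u, X))) \<partial>lborel \<partial>lborel)"
    using m by (subst lborel.nn_integral_fst[symmetric]) simp_all
  also have "\<dots> \<le> (\<integral>\<^sup>+u. ennreal c * ennreal (indicator {0..1} u * u powr (-1/2 - s)) + ennreal (2 * b) * ennreal (indicator {1..} u * u powr (-1 - s)) \<partial>lborel)"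
    by (intro nn_integral_mono slice)
  also have "\<dots> < \<infinity>"
    using s nn_integral_powr_from_0[of "-1/2 - s" 1] nn_integral_powr_atLeast[of s 1]
    by (simp add: nn_integral_add nn_integral_cmult ennreal_mult_less_top)
  finally show "(\<integral>\<^sup>+z. ennreal (norm (?H z)) \<partial>(lborel \<Otimes>\<^sub>M lborel)) < \<infinity>" .
qed

text \<open>All three parts are Fubini for one integrable function of time and space. The test
  function is an arbitrary bounded one: the choice 1 yields integrability of the fractional power,
  and dual evolutions yield the maximum principle.\<close>

lemma frac_pow_pairing:
  fixes f \<psi> :: "real^'n \<Rightarrow> real"
  assumes f: "schwartz f" and s: "0 < s" "s < 1/2"
    and \<psi>[measurable]: "\<psi> \<in> borel_measurable borel" and \<psi>1: "\<And>x. \<bar>\<psi> x\<bar> \<le> 1"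
  shows "integrable lborel (\<lambda>X. frac_pow Q B s f X * \<psi> X)" (is ?A)
    and "set_integrable lborel {0<..} (\<lambda>u. u powr (-1 - s) * (\<integral>X. (semigroup Q B u f X - f X) * \<psi> X \<partial>lborel))" (is ?B)
    and "(\<integral>X. frac_pow Q B s f X * \<psi> X \<partial>lborel) = - (s / Gamma (1 - s)) *
      (LINT u:{0<..}|lborel. u powr (-1 - s) * (\<integral>X. (semigroup Q B u f X - f X) * \<psi> X \<partial>lborel))" (is ?C)
proof -
  let ?h = "\<lambda>u X. indicator {0<..} u * (u powr (-1 - s) * (semigroup Q B u f X - f X)) * \<psi> X"
  have H: "integrable (lborel \<Otimes>\<^sub>M lborel) (\<lambda>(u, X). ?h u X)"
    using integrable_fractional_integrand[OF assms] by (simp add: case_prod_beta')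
  have X: "(\<integral>X. ?h u X \<partial>lborel) = indicator {0<..} u * (u powr (-1 - s) * (\<integral>X. (semigroup Q B u f X - f X) * \<psi> X \<partial>lborel))" for u
    by (simp add: mult.assoc)
  have U: "- (s / Gamma (1 - s)) * (\<integral>u. ?h u X \<partial>lborel) = frac_pow Q B s f X * \<psi> X" for X
    by (simp add: frac_pow_def set_lebesgue_integral_def)
  have "integrable lborel (\<lambda>X. - (s / Gamma (1 - s)) * (\<integral>u. ?h u X \<partial>lborel))"
    using lborel_pair.integrable_snd[OF H] by (intro integrable_mult_right) simp
  then show ?A unfolding U .
  show ?B
    using lborel_pair.integrable_fst[OF H] unfolding X by (simp add: set_integrable_def)
  have "(\<integral>X. frac_pow Q B s f X * \<psi> X \<partial>lborel) = - (s / Gamma (1 - s)) * (\<integral>X. (\<integral>u. ?h u X \<partial>lborel) \<partial>lborel)"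
    unfolding U[symmetric] by simp
  also have "(\<integral>X. (\<integral>u. ?h u X \<partial>lborel) \<partial>lborel) = (\<integral>u. (\<integral>X. ?h u X \<partial>lborel) \<partial>lborel)"
    using lborel_pair.Fubini_integral[OF H] by simp
  finally show ?C unfolding X by (simp add: set_lebesgue_integral_def)
qed

section \<open>The dual semigroup applied to an indicator\<close>

text \<open>The kernel formula has no meaning as a point mass at time 0, so the initial value is set
  by hand. \<open>enn2real\<close> loses nothing, since the integral is at most 1.\<close>

definition dual_indicator :: "(real^'n) set \<Rightarrow> real \<Rightarrow> real^'n \<Rightarrow> real" where
  "dual_indicator E \<tau> Y = (if \<tau> = 0 then indicator E Y
     else enn2real (\<integral>\<^sup>+X. indicator E X * ennreal (heat_kernel Q B X Y \<tau>) \<partial>lborel))"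

lemma ennreal_dual_indicator:
  assumes E: "E \<in> sets borel" and \<tau>: "0 < \<tau>"
  shows "ennreal (dual_indicator E \<tau> Y) = (\<integral>\<^sup>+X. indicator E X * ennreal (heat_kernel Q B X Y \<tau>) \<partial>lborel)"
    and "dual_indicator E \<tau> Y \<le> 1"
proof -
  have "(\<integral>\<^sup>+X. indicator E X * ennreal (heat_kernel Q B X Y \<tau>) \<partial>lborel) \<le> (\<integral>\<^sup>+X. ennreal (heat_kernel Q B X Y \<tau>) \<partial>lborel)"
    by (intro nn_integral_mono) (simp add: indicator_def)
  also have "\<dots> \<le> 1" by (rule nn_integral_heat_kernel_left[OF \<tau>])
  finally have le: "(\<integral>\<^sup>+X. indicator E X * ennreal (heat_kernel Q B X Y \<tau>) \<partial>lborel) \<le> 1" .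
  also have "1 < (top::ennreal)" by simp
  finally show "ennreal (dual_indicator E \<tau> Y) = (\<integral>\<^sup>+X. indicator E X * ennreal (heat_kernel Q B X Y \<tau>) \<partial>lborel)"
    using \<tau> by (simp add: dual_indicator_def)
  with le show "dual_indicator E \<tau> Y \<le> 1"
    by (metis ennreal_le_1)
qed

lemma dual_indicator_bounds:
  assumes "E \<in> sets borel" "0 \<le> \<tau>"
  shows "0 \<le> dual_indicator E \<tau> Y" "\<bar>dual_indicator E \<tau> Y\<bar> \<le> 1"
proof -
  show *: "0 \<le> dual_indicator E \<tau> Y" by (simp add: dual_indicator_def)
  show "\<bar>dual_indicator E \<tau> Y\<bar> \<le> 1"
    using * ennreal_dual_indicator(2)[OF assms(1), of \<tau> Y] assms(2)
    by (cases "\<tau> = 0") (auto simp: dual_indicator_def indicator_def)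
qed

lemma borel_measurable_dual_indicator:
  assumes [measurable]: "E \<in> sets borel" and \<tau>: "0 \<le> \<tau>"
  shows "dual_indicator E \<tau> \<in> borel_measurable borel"
proof (cases "\<tau> = 0")
  case True
  then show ?thesis by (simp add: dual_indicator_def[abs_def])
next
  case False
  with \<tau> have \<tau>: "0 < \<tau>" by simp
  have "(\<lambda>z. indicator E (snd z) * ennreal (heat_kernel Q B (snd z) (fst z) \<tau>)) \<in> borel_measurable (lborel \<Otimes>\<^sub>M lborel)"
    by (intro borel_measurable_times_ennreal measurable_compose[OF borel_measurable_heat_kernel_fixed[OF \<tau>]]) measurable
  then have "(\<lambda>Y. \<integral>\<^sup>+X. indicator E X * ennreal (heat_kernel Q B X Y \<tau>) \<partial>lborel) \<in> borel_measurable lborel"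
    by (intro lborel.borel_measurable_nn_integral) (simp add: case_prod_beta')
  then show ?thesis using False by (simp add: dual_indicator_def[abs_def])
qed

lemma dual_indicator_le:
  assumes E: "E \<in> sets borel" "emeasure lborel E < \<infinity>" and \<tau>: "0 < \<tau>"
    and k: "0 \<le> k" "\<And>X. heat_kernel Q B X Y \<tau> \<le> k"
  shows "dual_indicator E \<tau> Y \<le> k * measure lborel E"
proof -
  have "ennreal (dual_indicator E \<tau> Y) \<le> (\<integral>\<^sup>+X. ennreal k * indicator E X \<partial>lborel)"
    unfolding ennreal_dual_indicator(1)[OF E(1) \<tau>] using k
    by (intro nn_integral_mono) (auto simp: indicator_def ennreal_leI)
  also have "\<dots> = ennreal (k * measure lborel E)"
    using E k by (simp add: nn_integral_cmult emeasure_eq_ennreal_measure less_top ennreal_mult)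
  finally show ?thesis using k by (simp add: ennreal_le_iff)
qed

text \<open>Semigroup law of the dual evolution: Chapman-Kolmogorov after Tonelli for positive
  \<tau>, and the definition itself at \<tau> = 0.\<close>

lemma dual_indicator_semigroup:
  assumes E[measurable]: "E \<in> sets borel" and \<tau>: "0 \<le> \<tau>" and u: "0 < u"
  shows "(\<integral>\<^sup>+Y. ennreal (dual_indicator E \<tau> Y) * ennreal (heat_kernel Q B Y Z u) \<partial>lborel) = ennreal (dual_indicator E (\<tau> + u) Z)"
proof (cases "\<tau> = 0")
  case True
  then show ?thesis
    using ennreal_dual_indicator(1)[OF E u] by (simp add: dual_indicator_def ennreal_indicator)
next
  case False
  with \<tau> have \<tau>: "0 < \<tau>" by simp
  note [measurable] = borel_measurable_heat_kernel_fixed[OF \<tau>] borel_measurable_heat_kernel_fixed[OF u]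
  have "(\<integral>\<^sup>+Y. ennreal (dual_indicator E \<tau> Y) * ennreal (heat_kernel Q B Y Z u) \<partial>lborel)
      = (\<integral>\<^sup>+Y. \<integral>\<^sup>+X. indicator E X * ennreal (heat_kernel Q B X Y \<tau>) * ennreal (heat_kernel Q B Y Z u) \<partial>lborel \<partial>lborel)"
    unfolding ennreal_dual_indicator(1)[OF E \<tau>]
    by (intro nn_integral_cong nn_integral_multc[symmetric]) measurable
  also have "\<dots> = (\<integral>\<^sup>+X. \<integral>\<^sup>+Y. indicator E X * ennreal (heat_kernel Q B X Y \<tau>) * ennreal (heat_kernel Q B Y Z u) \<partial>lborel \<partial>lborel)"
    by (rule lborel_pair.Fubini') measurable
  also have "\<dots> = (\<integral>\<^sup>+X. indicator E X * (\<integral>\<^sup>+Y. ennreal (heat_kernel Q B X Y \<tau>) * ennreal (heat_kernel Q B Y Z u) \<partial>lborel) \<partial>lborel)"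
    unfolding mult.assoc by (intro nn_integral_cong nn_integral_cmult) measurable
  also have "\<dots> = ennreal (dual_indicator E (\<tau> + u) Z)"
    using \<tau> u by (simp add: heat_kernel_chapman_kolmogorov ennreal_dual_indicator(1)[OF E])
  finally show ?thesis .
qed

lemma integrable_mult_dual_indicator:
  fixes f :: "real^'n \<Rightarrow> real"
  assumes f: "integrable lborel f" and E: "E \<in> sets borel" and \<tau>: "0 \<le> \<tau>"
  shows "integrable lborel (\<lambda>Y. f Y * dual_indicator E \<tau> Y)"
proof (rule Bochner_Integration.integrable_bound[OF f])
  show "(\<lambda>Y. f Y * dual_indicator E \<tau> Y) \<in> borel_measurable lborel"
    using borel_measurable_dual_indicator[OF E \<tau>] borel_measurable_integrable[OF f] by measurable
  show "AE Y in lborel. norm (f Y * dual_indicator E \<tau> Y) \<le> norm (f Y)"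
    using dual_indicator_bounds[OF E \<tau>] by (auto simp: abs_mult intro!: AE_I2 mult_left_le)
qed

section \<open>The pairing as a function of time\<close>

definition dual_pairing :: "(real^'n) set \<Rightarrow> (real^'n \<Rightarrow> real) \<Rightarrow> real \<Rightarrow> real" where
  "dual_pairing E f \<tau> = (\<integral>Y. f Y * dual_indicator E \<tau> Y \<partial>lborel)"

text \<open>Fubini moves the semigroup from \<open>f\<close> to the test function, where it advances
  the time by \<open>u\<close>. Absolute integrability rests on the bound 1 for the test function
  and on mass at most one in the first kernel variable.\<close>

lemma semigroup_dual_pairing:
  fixes f :: "real^'n \<Rightarrow> real"
  assumes f: "integrable lborel f" and E: "E \<in> sets borel" and \<tau>: "0 \<le> \<tau>" and u: "0 < u"
  shows "integrable lborel (\<lambda>Y. semigroup Q B u f Y * dual_indicator E \<tau> Y)"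
    and "(\<integral>Y. semigroup Q B u f Y * dual_indicator E \<tau> Y \<partial>lborel) = dual_pairing E f (\<tau> + u)"
proof -
  note [measurable] = borel_measurable_heat_kernel_fixed[OF u] borel_measurable_integrable[OF f]
    borel_measurable_dual_indicator[OF E \<tau>]
  let ?h = "\<lambda>Y Z. heat_kernel Q B Y Z u * f Z * dual_indicator E \<tau> Y"
  have psi0: "0 \<le> dual_indicator E \<tau> Y" for Y using dual_indicator_bounds[OF E \<tau>] by simp
  have m: "(\<lambda>(Y, Z). ?h Y Z) \<in> borel_measurable (lborel \<Otimes>\<^sub>M lborel)" by measurable
  have H: "integrable (lborel \<Otimes>\<^sub>M lborel) (\<lambda>(Y, Z). ?h Y Z)"
  proof (rule integrableI_bounded[OF m])
    have "(\<integral>\<^sup>+z. ennreal (norm (case z of (Y, Z) \<Rightarrow> ?h Y Z)) \<partial>(lborel \<Otimes>\<^sub>M lborel)) =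
       (\<integral>\<^sup>+Y. \<integral>\<^sup>+Z. ennreal (norm (?h Y Z)) \<partial>lborel \<partial>lborel)"
      using m by (subst lborel.nn_integral_fst[symmetric]) simp_all
    also have "\<dots> \<le> (\<integral>\<^sup>+Y. \<integral>\<^sup>+Z. ennreal (heat_kernel Q B Y Z u) * ennreal \<bar>f Z\<bar> \<partial>lborel \<partial>lborel)"
      using dual_indicator_bounds[OF E \<tau>] heat_kernel_nonneg[OF u]
      by (intro nn_integral_mono) (auto simp: abs_mult intro!: ennreal_leI mult_left_le simp flip: ennreal_mult)
    also have "\<dots> \<le> (\<integral>\<^sup>+Z. ennreal \<bar>f Z\<bar> \<partial>lborel)"
      by (rule nn_integral_heat_kernel_mult_le[OF _ u]) measurable
    also have "\<dots> < \<infinity>" using f by (simp add: integrable_iff_bounded)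
    finally show "(\<integral>\<^sup>+z. ennreal (norm (case z of (Y, Z) \<Rightarrow> ?h Y Z)) \<partial>(lborel \<Otimes>\<^sub>M lborel)) < \<infinity>" .
  qed
  have Z: "(\<integral>Z. ?h Y Z \<partial>lborel) = semigroup Q B u f Y * dual_indicator E \<tau> Y" for Y
    by (simp add: semigroup_def)
  show "integrable lborel (\<lambda>Y. semigroup Q B u f Y * dual_indicator E \<tau> Y)"
    using lborel_pair.integrable_fst[OF H] unfolding Z .
  have Y: "(\<integral>Y. ?h Y Z \<partial>lborel) = f Z * dual_indicator E (\<tau> + u) Z" for Z
  proof -
    have "(\<integral>Y. dual_indicator E \<tau> Y * heat_kernel Q B Y Z u \<partial>lborel) = dual_indicator E (\<tau> + u) Z"
      using dual_indicator_semigroup[OF E \<tau> u, of Z] psi0 heat_kernel_nonneg[OF u] dual_indicator_bounds[OF E, of "\<tau> + u"] \<tau> u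
      by (subst integral_eq_nn_integral) (auto simp: ennreal_mult)
    moreover have "?h Y Z = f Z * (dual_indicator E \<tau> Y * heat_kernel Q B Y Z u)" for Y
      by (simp only: ac_simps)
    ultimately show ?thesis by (simp only: integral_mult_right_zero)
  qed
  have "(\<integral>Y. semigroup Q B u f Y * dual_indicator E \<tau> Y \<partial>lborel) = (\<integral>Z. (\<integral>Y. ?h Y Z \<partial>lborel) \<partial>lborel)"
    using lborel_pair.Fubini_integral[OF H] unfolding Z by simp
  then show "(\<integral>Y. semigroup Q B u f Y * dual_indicator E \<tau> Y \<partial>lborel) = dual_pairing E f (\<tau> + u)"
    unfolding Y dual_pairing_def .
qed

lemma dual_pairing_increment:
  fixes f :: "real^'n \<Rightarrow> real"
  assumes f: "integrable lborel f" and E: "E \<in> sets borel" and \<tau>: "0 \<le> \<tau>" and u: "0 < u"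
  shows "(\<integral>X. (semigroup Q B u f X - f X) * dual_indicator E \<tau> X \<partial>lborel) = dual_pairing E f (\<tau> + u) - dual_pairing E f \<tau>"
  unfolding left_diff_distrib
  using semigroup_dual_pairing[OF assms] integrable_mult_dual_indicator[OF f E \<tau>]
  by (simp add: dual_pairing_def)

lemma dual_pairing_increment_le:
  fixes f :: "real^'n \<Rightarrow> real"
  assumes f: "integrable lborel f" and E: "E \<in> sets borel" and \<tau>: "0 \<le> \<tau>" and u: "0 < u"
  shows "ennreal \<bar>dual_pairing E f (\<tau> + u) - dual_pairing E f \<tau>\<bar> \<le> kernel_modulus f u"
proof -
  have i: "integrable lborel (\<lambda>X. (semigroup Q B u f X - f X) * dual_indicator E \<tau> X)"
    unfolding left_diff_distrib
    using semigroup_dual_pairing[OF assms] integrable_mult_dual_indicator[OF f E \<tau>] by simp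
  have "ennreal \<bar>dual_pairing E f (\<tau> + u) - dual_pairing E f \<tau>\<bar>
      \<le> (\<integral>\<^sup>+X. ennreal (norm ((semigroup Q B u f X - f X) * dual_indicator E \<tau> X)) \<partial>lborel)"
    using integral_norm_bound_ennreal[OF i] by (simp add: dual_pairing_increment[OF assms])
  also have "\<dots> \<le> (\<integral>\<^sup>+X. ennreal \<bar>semigroup Q B u f X - f X\<bar> \<partial>lborel)"
    using dual_indicator_bounds[OF E \<tau>]
    by (intro nn_integral_mono) (auto simp: abs_mult intro!: ennreal_leI mult_left_le)
  also have "\<dots> \<le> kernel_modulus f u" by (rule nn_integral_semigroup_diff_le[OF f u])
  finally show ?thesis .
qed

lemma continuous_on_dual_pairing:
  assumes f: "schwartz f" and E: "E \<in> sets borel"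
  shows "continuous_on {0..t} (dual_pairing E f)"
proof -
  obtain c where c: "c \<ge> 0" "\<And>u. 0 < u \<Longrightarrow> u \<le> 1 \<Longrightarrow> kernel_modulus f u \<le> ennreal (c * sqrt u)"
    using heat_kernel_modulus_small_time[OF f] unfolding kernel_modulus_def by blast
  have step: "\<bar>dual_pairing E f y - dual_pairing E f x\<bar> \<le> c * sqrt (y - x)" if "0 \<le> x" "x < y" "y \<le> x + 1" for x y
    using order_trans[OF dual_pairing_increment_le[OF schwartz_integrable[OF f] E, of x "y - x"] c(2)[of "y - x"]] that c
    by (simp add: ennreal_le_iff)
  have hoelder: "\<bar>dual_pairing E f y - dual_pairing E f x\<bar> \<le> c * sqrt \<bar>y - x\<bar>" if "0 \<le> x" "0 \<le> y" "\<bar>y - x\<bar> \<le> 1" for x y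
    using step[of x y] step[of y x] that c by (cases x y rule: linorder_cases) (auto simp: abs_minus_commute)
  show ?thesis
    unfolding continuous_on_iff
  proof (intro ballI allI impI)
    fix x e :: real assume x: "x \<in> {0..t}" and e: "0 < e"
    show "\<exists>d>0. \<forall>x'\<in>{0..t}. dist x' x < d \<longrightarrow> dist (dual_pairing E f x') (dual_pairing E f x) < e"
    proof (intro exI conjI ballI impI)
      show "0 < min 1 ((e / (c + 1))\<^sup>2)" using e c by simp
      fix y assume y: "y \<in> {0..t}" "dist y x < min 1 ((e / (c + 1))\<^sup>2)"
      have "sqrt \<bar>y - x\<bar> < e / (c + 1)"
        using y e c by (intro real_less_lsqrt) (auto simp: dist_real_def)
      then have "(c + 1) * sqrt \<bar>y - x\<bar> < e" using c by (simp add: field_simps)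
      moreover have "c * sqrt \<bar>y - x\<bar> \<le> (c + 1) * sqrt \<bar>y - x\<bar>" by (intro mult_right_mono) auto
      ultimately show "dist (dual_pairing E f y) (dual_pairing E f x) < e"
        using hoelder[of x y] x y by (auto simp: dist_real_def)
    qed
  qed
qed

text \<open>The error \<epsilon> appears twice: once at time 0, once in the values beyond
  \<open>t\<close>. Should the left side be negative, \<open>ennreal\<close> truncates it to 0 and
  the claim is trivial.\<close>

lemma isoperimetric_estimate:
  fixes f :: "real^'n \<Rightarrow> real"
  assumes f: "schwartz f" and s: "0 < s" "s < 1/2" and t: "0 < t"
    and E[measurable]: "E \<in> sets borel" and E_fin: "emeasure lborel E < \<infinity>"
    and k: "0 \<le> k" "\<And>\<sigma> X Y. t \<le> \<sigma> \<Longrightarrow> heat_kernel Q B X Y \<sigma> \<le> k"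
    and \<epsilon>: "0 \<le> \<epsilon>" "L1norm (\<lambda>x. f x - indicator E x) \<le> ennreal \<epsilon>"
  shows "ennreal (measure lborel E - 2 * \<epsilon> - k * (measure lborel E)\<^sup>2)
    \<le> ennreal (Gamma (1 - s) * t powr s) * L1norm (frac_pow Q B s f)"
proof -
  note fi = schwartz_integrable[OF f]
  note [measurable] = schwartz_borel_measurable[OF f]
  let ?a = "dual_pairing E f" and ?E = "measure lborel E"
  have Ei: "integrable lborel (indicator E :: real^'n \<Rightarrow> real)"
    using E_fin by (simp add: integrable_real_indicator)
  have di: "integrable lborel (\<lambda>x. f x - indicator E x)"
    using fi Ei by simp
  have diff: "(\<integral>x. \<bar>f x - indicator E x\<bar> \<partial>lborel) \<le> \<epsilon>"
    using \<epsilon> di unfolding L1norm_def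
    by (subst (asm) nn_integral_eq_integral) (auto simp: ennreal_le_iff)
  \<comment> \<open>Test functions with values in [0,1] make the pairing 1-Lipschitz in L1,
    uniformly in \<tau>.\<close>
  have close: "\<bar>?a \<tau> - (\<integral>Y. indicator E Y * dual_indicator E \<tau> Y \<partial>lborel)\<bar> \<le> \<epsilon>" if \<tau>: "0 \<le> \<tau>" for \<tau>
  proof -
    have "?a \<tau> - (\<integral>Y. indicator E Y * dual_indicator E \<tau> Y \<partial>lborel) = (\<integral>Y. (f Y - indicator E Y) * dual_indicator E \<tau> Y \<partial>lborel)"
      unfolding dual_pairing_def left_diff_distrib
      by (rule Bochner_Integration.integral_diff[symmetric]) (rule integrable_mult_dual_indicator[OF _ E \<tau>] fi Ei)+
    also have "\<bar>\<dots>\<bar> \<le> (\<integral>Y. \<bar>f Y - indicator E Y\<bar> \<partial>lborel)"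
      using dual_indicator_bounds[OF E \<tau>] di
      by (intro integral_abs_bound[THEN order_trans] integral_mono integrable_abs integrable_mult_dual_indicator[OF di E \<tau>])
        (auto simp: abs_mult intro!: mult_left_le)
    finally show ?thesis using diff by simp
  qed
  have a0: "?E - \<epsilon> \<le> ?a 0"
  proof -
    have "(\<integral>Y. indicator E Y * dual_indicator E 0 Y \<partial>lborel) = (\<integral>Y. indicator E Y \<partial>lborel)"
      by (intro Bochner_Integration.integral_cong) (auto simp: dual_indicator_def indicator_def)
    then show ?thesis using close[of 0] by simp
  qed
  have far: "?a \<sigma> \<le> k * ?E\<^sup>2 + \<epsilon>" if \<sigma>: "t \<le> \<sigma>" for \<sigma>
  proof -
    have \<sigma>0: "0 < \<sigma>" using \<sigma> t by simp
    have "(\<integral>Y. indicator E Y * dual_indicator E \<sigma> Y \<partial>lborel) \<le> (\<integral>Y. indicator E Y * (k * ?E) \<partial>lborel)"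
      using dual_indicator_le[OF E E_fin \<sigma>0 k(1) k(2)[OF \<sigma>]] \<sigma>0
      by (intro integral_mono integrable_mult_dual_indicator Ei E mult_left_mono integrable_mult_left) auto
    also have "\<dots> = k * ?E\<^sup>2" by (simp add: power2_eq_square)
    finally show ?thesis using close[of \<sigma>] \<sigma>0 by simp
  qed
  have frac_int: "integrable lborel (frac_pow Q B s f)"
    using frac_pow_pairing(1)[OF f s, of "\<lambda>_. 1"] by simp
  define G where "G = Gamma (1 - s) / s * (\<integral>X. \<bar>frac_pow Q B s f X\<bar> \<partial>lborel)"
  have Gam: "0 < Gamma (1 - s)" using s by (intro Gamma_real_pos) auto
  have G0: "0 \<le> G" unfolding G_def using s Gam by (intro mult_nonneg_nonneg) auto
  \<comment> \<open>The increment formula holds for positive \<open>u\<close>; the indicator makes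
    the identity valid for all \<open>u\<close>.\<close>
  have inc: "indicator {0<..} u * (u powr (-1 - s) * (\<integral>X. (semigroup Q B u f X - f X) * dual_indicator E \<tau> X \<partial>lborel))
     = indicator {0<..} u * (u powr (-1 - s) * (?a (\<tau> + u) - ?a \<tau>))" if "0 \<le> \<tau>" for \<tau> u
    using dual_pairing_increment[OF fi E that, of u] by (auto simp: indicator_def)
  have "?a 0 \<le> (k * ?E\<^sup>2 + \<epsilon>) + s * t powr s * G"
  proof (rule fractional_maximum_principle[OF s(1) t continuous_on_dual_pairing[OF f E] far _ _ G0])
    fix \<tau> :: real assume "\<tau> \<in> {0..<t}"
    then have \<tau>: "0 \<le> \<tau>" by simp
    note pairing = frac_pow_pairing[OF f s borel_measurable_dual_indicator[OF E \<tau>] dual_indicator_bounds(2)[OF E \<tau>]]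
    show "set_integrable lborel {0<..} (\<lambda>u. u powr (-1 - s) * (?a (\<tau> + u) - ?a \<tau>))"
      using pairing(2) by (simp add: set_integrable_def inc[OF \<tau>])
    have "(\<integral>X. frac_pow Q B s f X * dual_indicator E \<tau> X \<partial>lborel) \<le> (\<integral>X. \<bar>frac_pow Q B s f X\<bar> \<partial>lborel)"
    proof (intro integral_mono pairing(1) integrable_abs frac_int)
      fix X
      have "frac_pow Q B s f X * dual_indicator E \<tau> X \<le> \<bar>frac_pow Q B s f X\<bar> * \<bar>dual_indicator E \<tau> X\<bar>"
        by (metis abs_ge_self abs_mult)
      also have "\<dots> \<le> \<bar>frac_pow Q B s f X\<bar>"
        using dual_indicator_bounds(2)[OF E \<tau>] by (intro mult_left_le) auto
      finally show "frac_pow Q B s f X * dual_indicator E \<tau> X \<le> \<bar>frac_pow Q B s f X\<bar>" .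
    qed
    then have "- (s / Gamma (1 - s)) * (LINT u:{0<..}|lborel. u powr (-1 - s) * (?a (\<tau> + u) - ?a \<tau>)) \<le> (\<integral>X. \<bar>frac_pow Q B s f X\<bar> \<partial>lborel)"
      unfolding pairing(3) by (simp add: set_lebesgue_integral_def inc[OF \<tau>])
    then show "- G \<le> (LINT u:{0<..}|lborel. u powr (-1 - s) * (?a (\<tau> + u) - ?a \<tau>))"
      using s Gam by (simp add: G_def field_simps)
  qed
  also have "s * t powr s * G = Gamma (1 - s) * t powr s * (\<integral>X. \<bar>frac_pow Q B s f X\<bar> \<partial>lborel)"
    using s by (simp add: G_def)
  finally have "?E - 2 * \<epsilon> - k * ?E\<^sup>2 \<le> Gamma (1 - s) * t powr s * (\<integral>X. \<bar>frac_pow Q B s f X\<bar> \<partial>lborel)"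
    using a0 by simp
  moreover have "L1norm (frac_pow Q B s f) = ennreal (\<integral>X. \<bar>frac_pow Q B s f X\<bar> \<partial>lborel)"
    unfolding L1norm_def using frac_int by (intro nn_integral_eq_integral) auto
  ultimately show ?thesis
    using Gam by (simp add: ennreal_leI flip: ennreal_mult)
qed

end

section \<open>The isoperimetric inequality\<close>

lemma omegaN_pos: "omegaN TYPE('n::finite) > 0"
  unfolding omegaN_def by (simp add: content_ball_pos)

text \<open>The dual evolution is built for Borel sets. Passing to an almost equal Borel set changes
  neither the measure nor any L1 distance to the indicator.\<close>

lemma lebesgue_set_AE_borel:
  fixes E :: "'a::euclidean_space set"
  assumes E: "E \<in> sets lebesgue"
  obtains S where "S \<in> sets borel" "AE x in lborel. x \<in> E \<longleftrightarrow> x \<in> S" "emeasure lborel S = emeasure lebesgue E"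
proof -
  obtain S N N' where S: "E = S \<union> N" "N \<subseteq> N'" "N' \<in> null_sets lborel" "S \<in> sets lborel"
    using E by (rule sets_completionE)
  have AE: "AE x in lborel. x \<in> E \<longleftrightarrow> x \<in> S"
    using AE_not_in[OF S(3)] by eventually_elim (use S in auto)
  have "emeasure lebesgue E = emeasure lebesgue S"
    using AE_completion[OF AE] E S(4) by (intro emeasure_eq_AE) auto
  also have "\<dots> = emeasure lborel S" using S(4) by (simp add: main_part_sets)
  finally show ?thesis using that[of S] S(4) AE by simp
qed

theorem theorem1p1:
  fixes D \<gamma> s :: real
  assumes "CARD('n) \<ge> 2" and "D > 0" and "\<gamma> > 0" and "0 < s" and "s < 1/2"
  shows "\<exists>i > 0. \<forall>(Q::real^'n^'n) (B::real^'n^'n).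
           (transpose Q = Q \<and> psd_mat Q \<and> (\<forall>t>0. pos_def_mat (Kmat Q B t)) \<and>
            trace B \<ge> 0 \<and> (\<forall>t>0. Vol Q B t \<ge> \<gamma> * t powr (D / 2))) \<longrightarrow>
           (\<forall>E. E \<in> sets lebesgue \<and> emeasure lebesgue E < \<infinity> \<longrightarrow>
              nl_perimeter Q B s E \<ge> ennreal (i * measure lebesgue E powr ((D - 2 * s) / D)))"
proof -
  define \<omega> where "\<omega> = omegaN TYPE('n)"
  define p where "p = (4 * pi) powr (- real CARD('n) / 2)"
  \<comment> \<open>By the volume growth, the kernel at time \<open>t\<close> is at most
    \<open>p * \<omega> / \<gamma>\<close> times \<open>t powr (- D / 2)\<close>. For a set of
    measure \<open>m\<close> this equals 1/(2m) exactly when \<open>t powr (D / 2) = q * m\<close>.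
    The constant \<open>i\<close> is what m/4 leaves after division by
    \<open>Gamma (1 - s) * t powr s\<close>.\<close>
  define q where "q = 2 * p * \<omega> / \<gamma>"
  define i where "i = q powr (- 2 * s / D) / (4 * Gamma (1 - s))"
  have \<omega>: "\<omega> > 0" unfolding \<omega>_def by (rule omegaN_pos)
  have p: "p > 0" by (simp add: p_def)
  have q: "q > 0" using assms \<omega> p by (simp add: q_def)
  have Gam: "Gamma (1 - s) > 0" using assms by (intro Gamma_real_pos) auto
  have bound: "ennreal (i * measure lebesgue E powr ((D - 2 * s) / D)) \<le> nl_perimeter Q B s E"
    if Q: "transpose Q = Q" "\<forall>t>0. pos_def_mat (Kmat Q B t)" "trace B \<ge> 0"
      and V: "\<forall>t>0. Vol Q B t \<ge> \<gamma> * t powr (D / 2)"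
      and E: "E \<in> sets lebesgue" "emeasure lebesgue E < \<infinity>" for Q B :: "real^'n^'n" and E
  proof (cases "measure lebesgue E = 0")
    case True
    \<comment> \<open>\<open>0 powr x\<close> is 0 for every exponent, so null sets are covered
      whatever the sign of \<open>D - 2 * s\<close>.\<close>
    then show ?thesis by simp
  next
    case False
    interpret kolmogorov Q B using Q by unfold_locales auto
    define m where "m = measure lebesgue E"
    have m: "m > 0" using False by (simp add: m_def zero_less_measure_iff)
    obtain S where S: "S \<in> sets borel" "AE x in lborel. x \<in> E \<longleftrightarrow> x \<in> S" "emeasure lborel S = emeasure lebesgue E"
      using lebesgue_set_AE_borel[OF E(1)] .
    have mS: "measure lborel S = m" using S(3) by (simp add: m_def measure_def)
    define t where "t = (q * m) powr (2 / D)"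
    have t: "t > 0" using q m by (simp add: t_def)
    have kernel: "heat_kernel Q B X Y \<sigma> \<le> 1 / (2 * m)" if \<sigma>: "t \<le> \<sigma>" for \<sigma> X Y
    proof -
      have \<sigma>0: "\<sigma> > 0" using \<sigma> t by simp
      have "\<gamma> * (q * m) = \<gamma> * t powr (D / 2)"
        using assms q m by (simp add: t_def powr_powr)
      also have "\<dots> \<le> \<gamma> * \<sigma> powr (D / 2)"
        using assms \<sigma> t by (intro mult_left_mono powr_mono2) auto
      also have "\<dots> \<le> \<omega> * sqrt (det (C \<sigma>))"
        using V \<sigma>0 by (auto simp: Vol_def \<omega>_def scaleR_Kmat)
      finally have "2 * p * m \<le> sqrt (det (C \<sigma>))"
        using assms \<omega> by (simp add: q_def)
      moreover have "det (C \<sigma>) powr (-1/2) = 1 / sqrt (det (C \<sigma>))"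
        using det_cov_pos[OF \<sigma>0] by (simp add: powr_minus_divide powr_half_sqrt)
      ultimately have "p * det (C \<sigma>) powr (-1/2) \<le> p * (1 / (2 * p * m))"
        using p m by (intro mult_left_mono) (auto intro!: divide_left_mono simp: det_cov_pos[OF \<sigma>0])
      also have "\<dots> = 1 / (2 * m)" using p by simp
      finally show ?thesis using heat_kernel_le[OF \<sigma>0, of X Y] by (simp add: p_def)
    qed
    have rate: "i * m powr ((D - 2 * s) / D) * (Gamma (1 - s) * t powr s) = m / 4"
    proof -
      have "t powr s = q powr (2 * s / D) * m powr (2 * s / D)"
        using q m by (simp add: t_def powr_powr powr_mult)
      then have "i * m powr ((D - 2 * s) / D) * (Gamma (1 - s) * t powr s) =
         (q powr (- 2 * s / D) * q powr (2 * s / D)) * (m powr ((D - 2 * s) / D) * m powr (2 * s / D)) / 4"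
        using Gam by (simp add: i_def)
      also have "m powr ((D - 2 * s) / D) * m powr (2 * s / D) = m"
        using m assms by (simp add: diff_divide_distrib flip: powr_add)
      also have "q powr (- 2 * s / D) * q powr (2 * s / D) = 1"
        using q by (simp flip: powr_add)
      finally show ?thesis by simp
    qed
    have "ennreal (i * m powr ((D - 2 * s) / D)) \<le> liminf (\<lambda>k. L1norm (frac_pow Q B s (fs k)))"
      if fs: "fs \<in> approx_seqs (indicator E)" for fs
    proof (rule Liminf_bounded)
      have "(\<lambda>k. L1norm (\<lambda>x. fs k x - indicator E x)) \<longlonglongrightarrow> 0"
        using fs by (simp add: approx_seqs_def)
      \<comment> \<open>With error m/8 and kernel bound 1/(2m), the estimate keeps m - m/4 - m/2 =
        m/4.\<close>
      then have "\<forall>\<^sub>F k in sequentially. L1norm (\<lambda>x. fs k x - indicator E x) < ennreal (m / 8)"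
        using m by (intro order_tendstoD) auto
      then show "\<forall>\<^sub>F k in sequentially. ennreal (i * m powr ((D - 2 * s) / D)) \<le> L1norm (frac_pow Q B s (fs k))"
      proof eventually_elim
        case (elim k)
        have f: "schwartz (fs k)" using fs by (simp add: approx_seqs_def)
        have "L1norm (\<lambda>x. fs k x - indicator S x) = L1norm (\<lambda>x. fs k x - indicator E x)"
          unfolding L1norm_def using S(2) by (intro nn_integral_cong_AE) (auto simp: indicator_def elim: eventually_mono)
        then have close: "L1norm (\<lambda>x. fs k x - indicator S x) \<le> ennreal (m / 8)" using elim by simp
        have "ennreal (Gamma (1 - s) * t powr s) * ennreal (i * m powr ((D - 2 * s) / D))
            = ennreal (i * m powr ((D - 2 * s) / D) * (Gamma (1 - s) * t powr s))"
          using Gam by (simp add: mult.commute flip: ennreal_mult')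
        also have "\<dots> = ennreal (measure lborel S - 2 * (m / 8) - 1 / (2 * m) * (measure lborel S)\<^sup>2)"
          using m unfolding rate by (simp add: mS power2_eq_square)
        also have "\<dots> \<le> ennreal (Gamma (1 - s) * t powr s) * L1norm (frac_pow Q B s (fs k))"
          using S E m by (intro isoperimetric_estimate f assms t kernel close) auto
        finally have "ennreal (Gamma (1 - s) * t powr s) * ennreal (i * m powr ((D - 2 * s) / D))
          \<le> ennreal (Gamma (1 - s) * t powr s) * L1norm (frac_pow Q B s (fs k))" .
        then show ?case
          using Gam t by (subst (asm) ennreal_mult_le_mult_iff) auto
      qed
    qed
    then show ?thesis
      unfolding nl_perimeter_def m_def by (intro INF_greatest)
  qed
  show ?thesis
  proof (intro exI conjI allI impI)
    show "i > 0" using q Gam by (simp add: i_def)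
  qed (use bound in blast)
qed

end
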